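(* Let $L$ be a planar triangulation with $n_L\ge 3$ vertices, embedded in the plane, and let $H$ be its planar conjugated triangulation. Two distinct faces of the second class of $H$ may have a common vertex, but they never have a common edge.
   Context: A planar triangulation is a maximal planar simple graph; fix a plane embedding of $L$, so all faces of $L$ are triangles. The planar conjugated triangulation $H$ of $L$ is the plane graph whose vertices are the midpoints of the edges of $L$, and in which, for every bounded face of $L$, the three midpoints of its three boundary edges are joined pairwise by three segments (medians) drawn inside that face; nothing is drawn inside the unbounded face of $L$. A bounded face of $H$ is of the second class if it contains a vertex of $L$ in its interior. *)

theory Defs
  imports "HOL-Analysis.Analysis"
begin

record 'a plane_graph =
  verts :: "'a set"
  edges :: "'a set set"
  point :: "'a \<Rightarrow> complex"
  curve :: "'a set \<Rightarrow> real \<Rightarrow> complex"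

definition simple_graph :: "'a set \<Rightarrow> 'a set set \<Rightarrow> bool" where
  "simple_graph V E \<longleftrightarrow> finite V \<and> (\<forall>e\<in>E. e \<subseteq> V \<and> card e = 2)"

text \<open>Edges are drawn as arbitrary Jordan arcs; straight-line drawings are the case
  in which every curve is a \<open>linepath\<close>.\<close>

definition plane_graph :: "'a plane_graph \<Rightarrow> bool" where
  "plane_graph G \<longleftrightarrow>
     simple_graph (verts G) (edges G) \<and>
     inj_on (point G) (verts G) \<and>
     (\<forall>e\<in>edges G.
        arc (curve G e) \<and>
        {pathstart (curve G e), pathfinish (curve G e)} = point G ` e \<and>
        path_image (curve G e) \<inter> point G ` verts G = point G ` e) \<and>
     (\<forall>e\<in>edges G. \<forall>e'\<in>edges G. e \<noteq> e' \<longrightarrow>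
        path_image (curve G e) \<inter> path_image (curve G e') = point G ` (e \<inter> e'))"

definition planar :: "'a set \<Rightarrow> 'a set set \<Rightarrow> bool" where
  "planar V E \<longleftrightarrow> (\<exists>G. plane_graph G \<and> verts G = V \<and> edges G = E)"

definition maximal_planar :: "'a set \<Rightarrow> 'a set set \<Rightarrow> bool" where
  "maximal_planar V E \<longleftrightarrow>
     simple_graph V E \<and> planar V E \<and>
     (\<forall>E'. simple_graph V E' \<and> E \<subset> E' \<longrightarrow> \<not> planar V E')"

definition plane_triangulation :: "'a plane_graph \<Rightarrow> bool" where
  "plane_triangulation L \<longleftrightarrow> plane_graph L \<and> maximal_planar (verts L) (edges L)"

definition drawing :: "'a plane_graph \<Rightarrow> complex set" where
  "drawing G = point G ` verts G \<union> (\<Union>e\<in>edges G. path_image (curve G e))"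

definition faces :: "'a plane_graph \<Rightarrow> complex set set" where
  "faces G = components (- drawing G)"

definition bounded_faces :: "'a plane_graph \<Rightarrow> complex set set" where
  "bounded_faces G = {F \<in> faces G. bounded F}"

definition boundary_verts :: "'a plane_graph \<Rightarrow> complex set \<Rightarrow> 'a set" where
  "boundary_verts G F = {v \<in> verts G. point G v \<in> frontier F}"

definition boundary_edges :: "'a plane_graph \<Rightarrow> complex set \<Rightarrow> 'a set set" where
  "boundary_edges G F = {e \<in> edges G. path_image (curve G e) \<subseteq> frontier F}"

definition triangular_face :: "'a plane_graph \<Rightarrow> complex set \<Rightarrow> bool" where
  "triangular_face G F \<longleftrightarrow>
     (\<exists>a b c. a \<noteq> b \<and> b \<noteq> c \<and> a \<noteq> c \<and>
        boundary_edges G F = {{a, b}, {b, c}, {a, c}} \<and>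
        frontier F = (\<Union>e\<in>boundary_edges G F. path_image (curve G e)))"

text \<open>The vertices of \<open>H\<close> are the edges of \<open>L\<close>, each placed at the midpoint of its curve;
  as the parametrisation of the curve is arbitrary, this may be any of its inner points,
  and it is the usual midpoint for a \<open>linepath\<close>. The edges of \<open>H\<close> (the medians) are the
  pairs of boundary edges of a common bounded face of \<open>L\<close>. That a bounded face of a plane
  triangulation has a triangle as its boundary is what makes the construction meaningful,
  so it is recorded here. The position of the medians inside a face is not determined when
  the edges of \<open>L\<close> are curved; hence this is a relation and not a function of \<open>L\<close>.\<close>

definition conjugated_triangulation :: "'a plane_graph \<Rightarrow> 'a set plane_graph \<Rightarrow> bool" where
  "conjugated_triangulation L H \<longleftrightarrow>
     plane_graph H \<and>
     verts H = edges L \<and>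
     (\<forall>e\<in>edges L. point H e = curve L e (1/2)) \<and>
     (\<forall>f\<in>bounded_faces L. triangular_face L f) \<and>
     edges H = {m. card m = 2 \<and> (\<exists>f\<in>bounded_faces L. m \<subseteq> boundary_edges L f)} \<and>
     (\<forall>f\<in>bounded_faces L. \<forall>m. card m = 2 \<and> m \<subseteq> boundary_edges L f \<longrightarrow>
        path_image (curve H m) \<subseteq> f \<union> point H ` m)"

definition second_class_faces :: "'a plane_graph \<Rightarrow> 'a set plane_graph \<Rightarrow> complex set set" where
  "second_class_faces L H = {F \<in> bounded_faces H. \<exists>v\<in>verts L. point L v \<in> interior F}"

end

theory Submission
  imports Defs
begin

text \<open>
  Let a median \<open>m\<close> lie in a bounded face \<open>f\<close> of \<open>L\<close>. The three medians in \<open>f\<close> form a Jordan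
  curve, and repeated splitting of \<open>f\<close> along theta graphs shows that near an inner point of \<open>m\<close>
  there are only two faces of \<open>H\<close>: the inside of this curve, which contains no vertex of \<open>L\<close>, and
  the one containing the corner of \<open>f\<close> cut off by \<open>m\<close>. So at most one face at \<open>m\<close> is of the second class.

  A common vertex occurs in the triangular bipyramid, \<open>K\<^sub>5\<close> minus an edge, drawn so that
  two adjacent vertices are inner: the midpoint of their edge lies on both faces. That this graph is a
  triangulation amounts to the non-planarity of \<open>K\<^sub>5\<close>: if a fourth vertex is inside a triangle,
  it splits the triangle into three, and the fifth vertex is separated from one of the others; if
  both remaining vertices are outside, an inversion brings them inside.
\<close>

section \<open>Arcs and Jordan curves\<close>

text \<open>The edges of \<open>L\<close> and the medians may be arbitrarily curved, so neither
  convexity nor angles can order them around a point. Everything is read off from one fact: a chord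
  splits the inside of a Jordan curve into two insides. After every split it must be decided on
  which side the remaining arcs run, and an end of the arc decides this. Arcs are handled as point
  sets with named ends, because the splits keep joining, cutting and reversing them and no
  parametrisation matters.

  The size of the example is forced. Nothing is drawn in the unbounded face of \<open>L\<close>, so
  the vertices on its boundary all lie in the unbounded face of \<open>H\<close>, and a face of the
  second class needs an inner vertex. A triangulation on four vertices has only one inner vertex;
  two of them take at least five vertices.

  Maximality of the example quantifies over all drawings of a larger graph, not only straight ones.
  Therefore \<open>K\<^sub>5\<close> has to be excluded for curved edges, with the same theta graph
  argument.\<close>

definition arc_between :: "complex set \<Rightarrow> complex \<Rightarrow> complex \<Rightarrow> bool" where
  "arc_between A a b \<longleftrightarrow> (\<exists>g. arc g \<and> path_image g = A \<and> pathstart g = a \<and> pathfinish g = b)"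

definition jordan_curve :: "complex set \<Rightarrow> bool" where
  "jordan_curve J \<longleftrightarrow> (\<exists>c. simple_path c \<and> pathfinish c = pathstart c \<and> path_image c = J)"

lemma arc_betweenI: "arc g \<Longrightarrow> arc_between (path_image g) (pathstart g) (pathfinish g)"
  by (auto simp: arc_between_def)

lemma arc_between_sym: "arc_between A a b \<Longrightarrow> arc_between A b a"
  unfolding arc_between_def
  by (metis arc_reversepath path_image_reversepath pathfinish_reversepath pathstart_reversepath)

lemma arc_between_ends:
  assumes "arc_between A a b" shows "a \<in> A" "b \<in> A" "a \<noteq> b"
  using assms arc_distinct_ends unfolding arc_between_def by force+

lemma arc_between_closed: "arc_between A a b \<Longrightarrow> closed A"
  unfolding arc_between_def using closed_arc_image by blast

lemma arc_between_connected_endless: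
  assumes "arc_between A a b" shows "connected (A - {a, b})" "A - {a, b} \<noteq> {}"
  using assms connected_simple_path_endless nonempty_simple_path_endless arc_imp_simple_path
  unfolding arc_between_def by blast+

text \<open>Serves arcs with one end on a curve that the rest of the arc avoids: the half-open arc
  is the image of a half-open interval and can still be placed on one side.\<close>

lemma arc_between_connected_diff:
  assumes "arc_between A a b" shows "connected (A - {b})"
proof -
  obtain g where g: "arc g" "path_image g = A" "pathstart g = a" "pathfinish g = b"
    using assms by (auto simp: arc_between_def)
  have inj: "inj_on g {0..1}" and "continuous_on {0..1} g"
    using g(1) by (auto simp: arc_def path_def)
  moreover have "A - {b} = g ` {0..<1}"
  proof -
    have "{0..1::real} = insert 1 {0..<1}" by auto
    moreover have "g 1 \<notin> g ` {0..<1}"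
      using inj_onD[OF inj, of 1] by force
    moreover have "A = g ` {0..1}" "b = g 1" using g(2,4) by (auto simp: path_image_def pathfinish_def)
    ultimately show ?thesis by (metis Diff_insert_absorb image_insert)
  qed
  moreover have "connected (g ` {0..<1})"
    by (rule connected_continuous_image)
      (use \<open>continuous_on {0..1} g\<close> in \<open>auto intro: continuous_on_subset\<close>)
  ultimately show ?thesis by simp
qed

text \<open>The open interval is dense in the closed one, and continuity carries this over. It turns
  information on the inner points of an arc into information on its ends.\<close>

lemma arc_between_subset_closure:
  assumes "arc_between A a b" shows "A \<subseteq> closure (A - {a, b})"
proof -
  obtain g where g: "arc g" "path_image g = A" "pathstart g = a" "pathfinish g = b"
    using assms by (auto simp: arc_between_def)
  have cont: "continuous_on (closure {0<..<1}) g"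
    using g(1) by (auto simp: arc_def path_def)
  have "g ` closure {0<..<1} \<subseteq> closure (g ` {0<..<1})"
    by (rule image_closure_subset[OF cont closed_closure closure_subset])
  then show ?thesis
    using g simple_path_endless[OF arc_imp_simple_path[OF g(1)]] by (auto simp: path_image_def)
qed

lemma arc_between_join:
  assumes "arc_between A a b" "arc_between B b c" "A \<inter> B = {b}"
  shows "arc_between (A \<union> B) a c"
proof -
  obtain g h where "arc g" "path_image g = A" "pathstart g = a" "pathfinish g = b"
    "arc h" "path_image h = B" "pathstart h = b" "pathfinish h = c"
    using assms by (auto simp: arc_between_def)
  then show ?thesis using assms(3) arc_join[of g h] unfolding arc_between_def
    by (intro exI[of _ "g +++ h"]) (auto simp: path_image_join)
qed

lemma arc_between_split:
  assumes "arc_between A a b" "z \<in> A" "z \<noteq> a" "z \<noteq> b"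
  obtains B C where "arc_between B a z" "arc_between C z b" "B \<inter> C = {z}" "B \<union> C = A"
proof -
  obtain g where g: "arc g" "path_image g = A" "pathstart g = a" "pathfinish g = b"
    using assms by (auto simp: arc_between_def)
  obtain t where t: "t \<in> {0..1}" "g t = z" using assms(2) g(2) by (auto simp: path_image_def)
  have t01: "0 < t" "t < 1"
    using t g(3,4) assms(3,4) by (auto simp: pathstart_def pathfinish_def less_eq_real_def)
  have inj: "inj_on g {0..1}" using g(1) by (auto simp: arc_def)
  have g01: "g 0 = a" "g 1 = b" using g(3,4) by (auto simp: pathstart_def pathfinish_def)
  show ?thesis
  proof
    show "arc_between (g ` {0..t}) a z"
      using arc_betweenI[of "subpath 0 t g"] arc_subpath_arc[OF g(1), of 0 t] t t01 g01
      by (simp add: path_image_subpath)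
    show "arc_between (g ` {t..1}) z b"
      using arc_betweenI[of "subpath t 1 g"] arc_subpath_arc[OF g(1), of t 1] t t01 g01
      by (simp add: path_image_subpath)
    show "g ` {0..t} \<union> g ` {t..1} = A"
      using g(2) t01 by (simp add: path_image_def image_Un[symmetric] ivl_disj_un_two_touch(4))
    have "{0..t} \<inter> {t..1} = {t}" using t01 by auto
    then show "g ` {0..t} \<inter> g ` {t..1} = {z}"
      using inj_on_image_Int[OF inj, of "{0..t}" "{t..1}"] t t01 by auto
  qed
qed

section \<open>Jordan curves, their two sides, and theta graphs\<close>

lemma jordan_curve_Un:
  assumes "arc_between A a b" "arc_between B a b" "A \<inter> B = {a, b}"
  shows "jordan_curve (A \<union> B)"
proof -
  obtain g h where "arc g" "path_image g = A" "pathstart g = a" "pathfinish g = b"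
    "arc h" "path_image h = B" "pathstart h = b" "pathfinish h = a"
    using assms(1) arc_between_sym[OF assms(2)] by (auto simp: arc_between_def)
  then show ?thesis using assms(3) simple_path_join_loop[of g h] unfolding jordan_curve_def
    by (intro exI[of _ "g +++ h"]) (auto simp: path_image_join)
qed

lemma jordan_curve_props:
  assumes "jordan_curve J"
  shows "closed J" "J \<noteq> {}" "inside J \<noteq> {}" "open (inside J)" "connected (inside J)"
    "bounded (inside J)" "frontier (inside J) = J" "open (outside J)" "connected (outside J)"
    "\<not> bounded (outside J)" "frontier (outside J) = J" "outside J \<noteq> {}"
  using assms Jordan_inside_outside closed_simple_path_image unfolding jordan_curve_def
  by (metis, metis path_image_nonempty, metis+)

lemma closure_inside_jordan:
  assumes "jordan_curve J" shows "closure (inside J) = inside J \<union> J"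
  using jordan_curve_props(7)[OF assms] by (metis closure_Un_frontier)

text \<open>The frontier of \<open>inside J\<close> is \<open>J\<close> itself, and a connected set
  that enters and leaves a set must meet its frontier.\<close>

lemma connected_subset_inside:
  assumes "jordan_curve J" "connected S" "S \<inter> J = {}" "S \<inter> inside J \<noteq> {}"
  shows "S \<subseteq> inside J"
  using connected_Int_frontier[OF assms(2,4)] jordan_curve_props(7)[OF assms(1)] assms(3) by auto

lemma connected_subset_outside:
  assumes "jordan_curve J" "connected S" "S \<inter> J = {}" "S \<inter> outside J \<noteq> {}"
  shows "S \<subseteq> outside J"
  using connected_Int_frontier[OF assms(2,4)] jordan_curve_props(11)[OF assms(1)] assms(3) by auto

lemma jordan_curve_arcs:
  assumes "jordan_curve J" "a \<in> J" "b \<in> J" "a \<noteq> b"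
  obtains A B where "arc_between A a b" "arc_between B a b" "A \<inter> B = {a, b}" "A \<union> B = J"
proof -
  obtain c where c: "simple_path c" "pathfinish c = pathstart c" "path_image c = J"
    using assms(1) by (auto simp: jordan_curve_def)
  obtain u d where "arc u" "arc d" "pathstart u = a" "pathfinish u = b" "pathstart d = b"
    "pathfinish d = a" "path_image u \<inter> path_image d = {a, b}" "path_image u \<union> path_image d = J"
    using exists_double_arc[OF c(1,2), of a b] assms(2-4) c(3) by metis
  then show ?thesis
    using that[of "path_image u" "path_image d"] arc_betweenI[of u] arc_between_sym arc_betweenI[of d]
    by metis
qed

text \<open>\<open>A\<close> is a chord of the Jordan curve \<open>A1 \<union> A2\<close>. Every
  separation argument for curved edges and medians goes back to this splitting.\<close>

lemma theta_split:
  assumes "arc_between A1 a b" "arc_between A2 a b" "arc_between A a b"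
    and "A1 \<inter> A2 = {a, b}" "A1 \<inter> A = {a, b}" "A2 \<inter> A = {a, b}"
    and "A \<inter> inside (A1 \<union> A2) \<noteq> {}"
  shows "inside (A1 \<union> A) \<inter> inside (A2 \<union> A) = {}"
    and "inside (A1 \<union> A2) = inside (A1 \<union> A) \<union> inside (A2 \<union> A) \<union> (A - {a, b})"
proof -
  obtain g1 g2 g where g: "arc g1" "path_image g1 = A1" "pathstart g1 = a" "pathfinish g1 = b"
    "arc g2" "path_image g2 = A2" "pathstart g2 = a" "pathfinish g2 = b"
    "arc g" "path_image g = A" "pathstart g = a" "pathfinish g = b"
    using assms(1-3) unfolding arc_between_def by blast
  have "inside (A1 \<union> A) \<inter> inside (A2 \<union> A) = {} \<and>
    inside (A1 \<union> A2) = inside (A1 \<union> A) \<union> inside (A2 \<union> A) \<union> (A - {a, b})"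
    by (rule split_inside_simple_closed_curve[of g1 a b g2 g])
      (use g assms arc_imp_simple_path arc_between_ends(3)[OF assms(1)] in auto)
  then show "inside (A1 \<union> A) \<inter> inside (A2 \<union> A) = {}"
    "inside (A1 \<union> A2) = inside (A1 \<union> A) \<union> inside (A2 \<union> A) \<union> (A - {a, b})" by auto
qed

text \<open>The arc chooses its side by an end that is not on the closure of the other side.\<close>
lemma arc_in_theta_side:
  assumes "inside J \<subseteq> inside J1 \<union> inside J2 \<union> S" "jordan_curve J1" "jordan_curve J2"
    and "inside J1 \<inter> inside J2 = {}"
    and "arc_between A a b" "A - {a, b} \<subseteq> inside J" "(A - {a, b}) \<inter> S = {}"
    and "a \<notin> inside J1 \<union> J1"
  shows "A - {a, b} \<subseteq> inside J2"
proof (rule ccontr)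
  assume "\<not> ?thesis"
  then have "(A - {a, b}) \<inter> inside J1 \<noteq> {}" using assms(1,6,7) by blast
  then have "A - {a, b} \<subseteq> inside J1"
    using connectedD[OF arc_between_connected_endless(1)[OF assms(5)], of "inside J1" "inside J2"]
      jordan_curve_props(4) assms by blast
  then have "A \<subseteq> closure (inside J1)"
    using arc_between_subset_closure[OF assms(5)] closure_mono by blast
  then show False
    using assms(8) arc_between_ends(1)[OF assms(5)] closure_inside_jordan[OF assms(2)] by blast
qed

text \<open>Three cuts dissect the inside of \<open>J\<close>: the chord \<open>K\<close> cuts off
  the corner \<open>?C\<close>, then \<open>K2\<close> cuts off \<open>?P\<close>, then
  \<open>K1\<close> cuts off \<open>?Q\<close>, and \<open>?T\<close> is what remains in the middle.
  The set \<open>C\<close> handed out is the corner behind \<open>K\<close>; it is connected, so a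
  face that meets it and is not separated from it by the drawing contains all of it.\<close>

lemma medial_triangle_nbhd:
  assumes J: "jordan_curve J" and "x \<in> J" "y \<in> J" "z \<in> J" and "x \<noteq> y" "y \<noteq> z" "x \<noteq> z"
    and K: "arc_between K x y" and K1: "arc_between K1 y z" and K2: "arc_between K2 z x"
    and "K - {x, y} \<subseteq> inside J" "K1 - {y, z} \<subseteq> inside J" "K2 - {z, x} \<subseteq> inside J"
    and "K \<inter> K1 = {y}" "K1 \<inter> K2 = {z}" "K \<inter> K2 = {x}"
  obtains C where "connected C" "C \<subseteq> inside J" "C \<inter> (K \<union> K1 \<union> K2) = {}"
    "\<And>p. p \<in> K - {x, y} \<Longrightarrow> \<exists>U. open U \<and> p \<in> U \<and> U \<subseteq> C \<union> inside (K \<union> K1 \<union> K2) \<union> K"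
    "jordan_curve (K \<union> K1 \<union> K2)" "inside (K \<union> K1 \<union> K2) \<subseteq> inside J"
proof -
  have nJ: "w \<in> J \<Longrightarrow> w \<notin> inside J" for w using inside_no_overlap[of J] by blast
  \<comment> \<open>Of the two arcs of \<open>J\<close> between \<open>x\<close> and
    \<open>y\<close>, the one without \<open>z\<close> will bound the corner cut off by
    \<open>K\<close>.\<close>
  have "\<exists>A B. arc_between A x y \<and> arc_between B x y \<and> A \<inter> B = {x, y} \<and> A \<union> B = J \<and> z \<in> B"
  proof -
    obtain A B where "arc_between A x y" "arc_between B x y" "A \<inter> B = {x, y}" "A \<union> B = J"
      using jordan_curve_arcs[OF J \<open>x \<in> J\<close> \<open>y \<in> J\<close> \<open>x \<noteq> y\<close>] .
    then show ?thesis using \<open>z \<in> J\<close> by (cases "z \<in> B") (blast, metis Int_commute Un_commute UnE)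
  qed
  then obtain A1 A2 where A1: "arc_between A1 x y" and A2: "arc_between A2 x y"
    and A: "A1 \<inter> A2 = {x, y}" "A1 \<union> A2 = J" "z \<in> A2" by blast
  obtain B1 B2 where B1: "arc_between B1 x z" and B2: "arc_between B2 z y"
    and B: "B1 \<inter> B2 = {z}" "B1 \<union> B2 = A2"
    using arc_between_split[OF A2 \<open>z \<in> A2\<close>] \<open>x \<noteq> z\<close> \<open>y \<noteq> z\<close> by metis
  note ends = arc_between_ends[OF A1] arc_between_ends[OF A2] arc_between_ends[OF B1]
    arc_between_ends[OF B2] arc_between_ends[OF K] arc_between_ends[OF K1] arc_between_ends[OF K2]
  have KJ: "K \<inter> J = {x, y}" "K1 \<inter> J = {y, z}" "K2 \<inter> J = {z, x}"
    using assms(2-7,11-13) nJ ends by blast+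
  have yB1: "y \<notin> B1" and xB2: "x \<notin> B2" and zA1: "z \<notin> A1"
    using A B ends by blast+
  have zK: "z \<notin> K" and yK2: "y \<notin> K2" and xK1: "x \<notin> K1" using assms(5-7,14-16) ends by blast+
  let ?C = "inside (A1 \<union> K)" and ?R = "inside (A2 \<union> K)" and ?P = "inside (B1 \<union> K2)"
  let ?R2 = "inside (B2 \<union> K \<union> K2)" and ?Q = "inside (B2 \<union> K1)" and ?T = "inside (K \<union> K1 \<union> K2)"
  have A1K: "A1 \<inter> K = {x, y}" and A2K: "A2 \<inter> K = {x, y}" using KJ A ends by blast+
  have jC: "jordan_curve (A1 \<union> K)" and jR: "jordan_curve (A2 \<union> K)"
    using jordan_curve_Un A1 A2 K A1K A2K by blast+
  have Kin: "K \<inter> inside (A1 \<union> A2) \<noteq> {}"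
    using arc_between_connected_endless(2)[OF K] assms(11) A by blast
  note s1 = theta_split[OF A1 A2 K A(1) A1K A2K Kin, unfolded A(2)]
  \<comment> \<open>Both \<open>K1\<close> and \<open>K2\<close> end at \<open>z\<close>. As
    \<open>z\<close> is off the closure of the corner \<open>?C\<close>, this end sends both arcs to
    the other side \<open>?R\<close>.\<close>
  have zC: "z \<notin> ?C \<union> (A1 \<union> K)" using s1(2) nJ[OF \<open>z \<in> J\<close>] zA1 zK by blast
  have dK1: "K1 - {y, z} \<subseteq> inside J" "(K1 - {y, z}) \<inter> (K - {x, y}) = {}"
    and dK2: "K2 - {x, z} \<subseteq> inside J" "(K2 - {x, z}) \<inter> (K - {x, y}) = {}"
    using assms(12-14,16) by blast+
  have K1R: "K1 - {z, y} \<subseteq> ?R"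
    by (rule arc_in_theta_side[OF equalityD1[OF s1(2)] jC jR s1(1) arc_between_sym[OF K1]])
      (use dK1 dK2 zC in \<open>auto simp: insert_commute\<close>)
  have K2R: "K2 - {z, x} \<subseteq> ?R"
    by (rule arc_in_theta_side[OF equalityD1[OF s1(2)] jC jR s1(1) K2])
      (use dK1 dK2 zC in \<open>auto simp: insert_commute\<close>)

  have BJ: "B1 \<subseteq> J" "B2 \<subseteq> J" using A(2) B(2) by blast+
  have B2K: "B2 \<inter> K = {y}"
  proof -
    have "B2 \<inter> K \<subseteq> {x, y}" using A2K B(2) by blast
    then show ?thesis using xB2 ends(11,14) by blast
  qed
  have B1K: "B1 \<inter> K = {x}"
  proof -
    have "B1 \<inter> K \<subseteq> {x, y}" using A2K B(2) by blast
    then show ?thesis using yB1 ends(7,13) by blast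
  qed
  \<comment> \<open>Second theta graph, with ends \<open>z\<close> and \<open>x\<close>: the
    boundary of \<open>?R\<close> is \<open>B1\<close> together with the detour
    \<open>B2 \<union> K\<close> through \<open>y\<close>, and \<open>K2\<close> is the
    chord.\<close>
  have BK: "arc_between (B2 \<union> K) z x"
    by (rule arc_between_join[OF B2 arc_between_sym[OF K]]) (rule B2K)
  have i21: "B1 \<inter> (B2 \<union> K) = {z, x}" using B(1) B1K by auto
  have i22: "B1 \<inter> K2 = {z, x}" using KJ(3) BJ(1) ends(7,8,19,20) by blast
  have B2K2: "B2 \<inter> K2 = {z}"
  proof -
    have "B2 \<inter> K2 \<subseteq> {z, x}" using KJ(3) BJ(2) by blast
    then show ?thesis using xB2 ends(10,19) by blast
  qed
  have i23: "(B2 \<union> K) \<inter> K2 = {z, x}" using assms(16) B2K2 by auto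
  have e2: "B1 \<union> (B2 \<union> K) = A2 \<union> K" using B by blast
  have K2in: "K2 \<inter> inside (B1 \<union> (B2 \<union> K)) \<noteq> {}"
    using arc_between_connected_endless(2)[OF K2] K2R e2 by auto
  note s2 = theta_split[OF arc_between_sym[OF B1] BK K2 i21 i22 i23 K2in, unfolded e2]
  have jP: "jordan_curve (B1 \<union> K2)" and jR2: "jordan_curve (B2 \<union> K \<union> K2)"
    using jordan_curve_Un[OF arc_between_sym[OF B1] K2 i22] jordan_curve_Un[OF BK K2 i23]
    by auto
  have yR: "y \<notin> ?R" using inside_no_overlap[of "A2 \<union> K"] ends(5) by blast
  then have yP: "y \<notin> ?P" using s2(2) by blast
  \<comment> \<open>Now \<open>z\<close> lies on the boundary of both parts and decides nothing; the
    other end \<open>y\<close> is off the closure of \<open>?P\<close>.\<close>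
  have K1R2: "K1 - {y, z} \<subseteq> ?R2"
    by (rule arc_in_theta_side[OF equalityD1[OF s2(2)] jP jR2 s2(1) K1])
      (use K1R assms(15) yB1 yK2 yP in \<open>auto simp: insert_commute\<close>)

  \<comment> \<open>Third theta graph, with ends \<open>y\<close> and \<open>z\<close>:
    \<open>B2\<close> and \<open>K \<union> K2\<close> bound \<open>?R2\<close>, and the chord
    \<open>K1\<close> leaves the medial triangle as one of the two parts.\<close>
  have KK: "arc_between (K \<union> K2) y z"
    by (rule arc_between_join[OF arc_between_sym[OF K] arc_between_sym[OF K2]]) (use assms(16) in blast)
  have i31: "B2 \<inter> (K \<union> K2) = {y, z}" using B2K B2K2 by auto
  have i32: "B2 \<inter> K1 = {y, z}" using KJ(2) BJ(2) ends(10,11,16,17) by blast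
  have i33: "(K \<union> K2) \<inter> K1 = {y, z}" using assms(14,15) by blast
  have e3: "B2 \<union> (K \<union> K2) = B2 \<union> K \<union> K2" by blast
  have K1in: "K1 \<inter> inside (B2 \<union> (K \<union> K2)) \<noteq> {}"
    using arc_between_connected_endless(2)[OF K1] K1R2 e3 by auto
  note s3 = theta_split[OF arc_between_sym[OF B2] KK K1 i31 i32 i33 K1in, unfolded e3]
  have e4: "K \<union> K2 \<union> K1 = K \<union> K1 \<union> K2" by blast
  have jQ: "jordan_curve (B2 \<union> K1)" and jT: "jordan_curve (K \<union> K1 \<union> K2)"
    using jordan_curve_Un[OF arc_between_sym[OF B2] K1 i32] jordan_curve_Un[OF KK K1 i33] e4
    by auto
  show ?thesis
  proof
    show "connected ?C" by (rule jordan_curve_props(5)[OF jC])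
    show "?C \<subseteq> inside J" using s1 by blast
    show "?C \<inter> (K \<union> K1 \<union> K2) = {}"
    proof -
      have "?C \<inter> K = {}" using inside_no_overlap[of "A1 \<union> K"] by blast
      then show ?thesis using K1R K2R s1 nJ \<open>x \<in> J\<close> \<open>y \<in> J\<close> \<open>z \<in> J\<close> by blast
    qed
    show "jordan_curve (K \<union> K1 \<union> K2)" by (rule jT)
    show "?T \<subseteq> inside J" using s1 s2 s3 e4 by auto
    \<comment> \<open>Take away the other two medians and the closures of the other two corners. All
      of these are closed and miss the inner point \<open>p\<close> of \<open>K\<close>, and by the
      three splittings only \<open>?C\<close>, \<open>?T\<close> and points of \<open>K\<close> are
      left.\<close>
    show "\<exists>U. open U \<and> p \<in> U \<and> U \<subseteq> ?C \<union> ?T \<union> K" if p: "p \<in> K - {x, y}" for p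
    proof (intro exI[of _ "inside J - (K1 \<union> K2 \<union> closure ?P \<union> closure ?Q)"] conjI)
      show "open (inside J - (K1 \<union> K2 \<union> closure ?P \<union> closure ?Q))"
        using jordan_curve_props(4)[OF J] arc_between_closed[OF K1] arc_between_closed[OF K2]
        by (intro open_Diff closed_Un) auto
      have "?R \<inter> K = {}" using inside_no_overlap[of "A2 \<union> K"] by blast
      moreover have "?P \<subseteq> ?R" "?Q \<subseteq> ?R" unfolding s2(2) s3(2) by blast+
      ultimately have "p \<notin> ?P" "p \<notin> ?Q" using p by blast+
      moreover have "p \<notin> J" using p KJ(1) by blast
      moreover have "p \<notin> K1" using p assms(14) by blast
      moreover have "p \<notin> K2" using p assms(16) by blast
      moreover have "p \<in> inside J" using p assms(11) by blast
      ultimately show "p \<in> inside J - (K1 \<union> K2 \<union> closure ?P \<union> closure ?Q)"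
        unfolding closure_inside_jordan[OF jP] closure_inside_jordan[OF jQ] using BJ by blast
      show "inside J - (K1 \<union> K2 \<union> closure ?P \<union> closure ?Q) \<subseteq> ?C \<union> ?T \<union> K"
        unfolding s1(2) s2(2) s3(2) e4 using closure_subset[of ?P] closure_subset[of ?Q] by blast
    qed
  qed
qed

section \<open>Plane graphs and their faces\<close>

text \<open>A region whose whole boundary is drawn traps every face that enters it. The exact shape
  of the face need not be known.\<close>

lemma frontier_subset_component:
  assumes "F \<in> components (- D)" "frontier T \<subseteq> D" "F \<inter> T \<noteq> {}"
  shows "F \<subseteq> T"
  using connected_Int_frontier[OF in_components_connected[OF assms(1)] assms(3)] assms(2)
    in_components_subset[OF assms(1)] by blast

lemma component_eqI:
  assumes "F \<in> components (- D)" "connected T" "T \<inter> D = {}" "frontier T \<subseteq> D" "F \<inter> T \<noteq> {}"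
  shows "F = T"
  using frontier_subset_component[OF assms(1,4,5)] components_maximal[OF assms(1,2)] assms(3,5)
  by blast

text \<open>A connected set that misses \<open>J\<close> and meets \<open>f\<close> lies in
  \<open>f\<close>. If \<open>f\<close> met the outside of \<open>J\<close> it would contain all of
  it and be unbounded; hence it lies inside, and the same principle gives the converse
  inclusion.\<close>

lemma bounded_component_eq_inside:
  assumes f: "f \<in> components (- D)" and "closed D" "bounded f" "frontier f = J" "jordan_curve J"
  shows "f = inside J"
proof -
  have "f \<inter> J = {}"
    using open_components[OF _ f] \<open>closed D\<close> \<open>frontier f = J\<close> frontier_disjoint_eq by auto
  have sub: "S \<subseteq> f" if "connected S" "S \<inter> J = {}" "S \<inter> f \<noteq> {}" for S
    using connected_Int_frontier[of S f] that \<open>frontier f = J\<close> by blast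
  have "f \<inter> outside J = {}"
    using sub[OF jordan_curve_props(9)[OF \<open>jordan_curve J\<close>]] outside_no_overlap[of J]
      jordan_curve_props(10)[OF \<open>jordan_curve J\<close>] bounded_subset[OF \<open>bounded f\<close>] by blast
  then have "f \<subseteq> inside J" using \<open>f \<inter> J = {}\<close> inside_Un_outside[of J] by blast
  moreover have "inside J \<subseteq> f"
    using sub[OF jordan_curve_props(5)[OF \<open>jordan_curve J\<close>]] inside_no_overlap[of J]
      \<open>f \<subseteq> inside J\<close> in_components_nonempty[OF f] by blast
  ultimately show ?thesis by blast
qed

section \<open>Edges, midpoints and triangles of a plane graph\<close>

abbreviation edge_image :: "'a plane_graph \<Rightarrow> 'a \<Rightarrow> 'a \<Rightarrow> complex set" where
  "edge_image G a b \<equiv> path_image (curve G {a, b})"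

definition triangle :: "'a plane_graph \<Rightarrow> 'a \<Rightarrow> 'a \<Rightarrow> 'a \<Rightarrow> complex set" where
  "triangle G a b c = edge_image G a b \<union> edge_image G b c \<union> edge_image G a c"

lemma triangle_perm:
  "triangle G b a c = triangle G a b c" "triangle G a c b = triangle G a b c"
  by (auto simp: triangle_def insert_commute)

text \<open>\<open>plane_graph\<close> fixes the ends of a curve only as an unordered pair. The
  symmetry of \<open>arc_between\<close> hides the orientation, so \<open>{a, b}\<close> can be used
  in either order.\<close>

lemma plane_graph_arc:
  assumes "plane_graph G" "{a, b} \<in> edges G"
  shows "arc_between (edge_image G a b) (point G a) (point G b)"
proof -
  have "arc (curve G {a, b})"
    and "{pathstart (curve G {a, b}), pathfinish (curve G {a, b})} = {point G a, point G b}"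
    using assms unfolding plane_graph_def by auto
  then show ?thesis
    using arc_betweenI arc_between_sym by (metis doubleton_eq_iff)
qed

lemma plane_graph_Int:
  assumes "plane_graph G" "e \<in> edges G" "e' \<in> edges G" "e \<noteq> e'"
  shows "path_image (curve G e) \<inter> path_image (curve G e') = point G ` (e \<inter> e')"
  using assms unfolding plane_graph_def by blast

lemma plane_graph_edge:
  assumes "plane_graph G" "e \<in> edges G"
  shows "e \<subseteq> verts G" "card e = 2" "finite e"
  using assms card.infinite unfolding plane_graph_def simple_graph_def by fastforce+

lemma plane_graph_finite:
  assumes "plane_graph G" shows "finite (verts G)" "finite (edges G)"
proof -
  show "finite (verts G)" using assms by (auto simp: plane_graph_def simple_graph_def)
  then show "finite (edges G)"
    using plane_graph_edge(1)[OF assms] by (intro finite_subset[of "edges G" "Pow (verts G)"]) auto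
qed

lemma closed_drawing:
  assumes "plane_graph G" shows "closed (drawing G)"
proof -
  have "closed (path_image (curve G e))" if "e \<in> edges G" for e
    using assms that closed_arc_image by (auto simp: plane_graph_def)
  then show ?thesis
    unfolding drawing_def using plane_graph_finite[OF assms]
    by (intro closed_Un closed_UN finite_imp_closed finite_imageI) auto
qed

lemma edge_subset_drawing: "e \<in> edges G \<Longrightarrow> path_image (curve G e) \<subseteq> drawing G"
  by (auto simp: drawing_def)

lemma curve_half_in_path_image: "curve G e (1/2) \<in> path_image (curve G e)"
  by (auto simp: path_image_def)

lemma curve_half_notin_ends:
  assumes "plane_graph G" "e \<in> edges G" shows "curve G e (1/2) \<notin> point G ` e"
proof -
  have "inj_on (curve G e) {0..1}" and
    ends: "{curve G e 0, curve G e 1} = point G ` e"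
    using assms by (auto simp: plane_graph_def arc_def pathstart_def pathfinish_def)
  then have "curve G e (1/2) \<noteq> curve G e 0" "curve G e (1/2) \<noteq> curve G e 1"
    by (auto dest: inj_onD)
  then show ?thesis using ends by auto
qed

text \<open>Two edges meet only in common vertices, and the midpoint is not one of them because the
  curve is injective. So an edge can be recognised by its midpoint; this also makes the vertices of
  \<open>H\<close> distinct.\<close>

lemma curve_half_in_edge:
  assumes "plane_graph G" "e \<in> edges G" "e' \<in> edges G" "curve G e (1/2) \<in> path_image (curve G e')"
  shows "e = e'"
  using plane_graph_Int[OF assms(1-3)] curve_half_notin_ends[OF assms(1,2)]
    curve_half_in_path_image[of G e] assms(4) by blast

lemma edge_image_Int:
  assumes "plane_graph G" "{a, b} \<in> edges G" "{b, c} \<in> edges G" "a \<noteq> c"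
  shows "edge_image G a b \<inter> edge_image G b c = {point G b}"
proof -
  have "{a, b} \<noteq> {b, c}" using assms(4) by (auto simp: doubleton_eq_iff)
  moreover have "a \<noteq> b" "b \<noteq> c" using plane_graph_edge(2)[OF assms(1)] assms(2,3) by fastforce+
  ultimately show ?thesis using plane_graph_Int[OF assms(1-3)] assms(4) by auto
qed

lemma triangle_jordan:
  assumes G: "plane_graph G" and "{a, b} \<in> edges G" "{b, c} \<in> edges G" "{a, c} \<in> edges G"
    and "a \<noteq> b" "b \<noteq> c" "a \<noteq> c"
  shows "jordan_curve (triangle G a b c)"
proof -
  have "{b, a} \<in> edges G" "{c, b} \<in> edges G" "{c, a} \<in> edges G"
    using assms by (simp_all add: insert_commute)
  note i = edge_image_Int[OF G \<open>{a, b} \<in> edges G\<close> \<open>{b, c} \<in> edges G\<close>]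
    edge_image_Int[OF G \<open>{b, a} \<in> edges G\<close> \<open>{a, c} \<in> edges G\<close>]
    edge_image_Int[OF G \<open>{b, c} \<in> edges G\<close> \<open>{c, a} \<in> edges G\<close>]
  have "arc_between (edge_image G a b \<union> edge_image G b c) (point G a) (point G c)"
    by (rule arc_between_join[OF plane_graph_arc plane_graph_arc]) (use G assms(2-7) i(1) in auto)
  moreover have "(edge_image G a b \<union> edge_image G b c) \<inter> edge_image G a c = {point G a, point G c}"
    using i(2)[OF \<open>b \<noteq> c\<close>] i(3)[OF \<open>a \<noteq> b\<close>[symmetric]]
    by (simp add: insert_commute Int_Un_distrib2)
  ultimately show ?thesis
    using jordan_curve_Un plane_graph_arc[OF G \<open>{a, c} \<in> edges G\<close>] unfolding triangle_def by blast
qed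

lemma card_2_in_triple:
  assumes "card m = 2" "m \<subseteq> {p, q, r}" "p \<noteq> q" "q \<noteq> r" "p \<noteq> r"
  obtains x y z where "m = {x, y}" "{p, q, r} = {x, y, z}" "x \<noteq> y" "y \<noteq> z" "x \<noteq> z"
proof -
  obtain x y where m: "m = {x, y}" "x \<noteq> y" using assms(1) by (auto simp: card_2_iff)
  have "card ({p, q, r} - m) = 1" using assms by (subst card_Diff_subset) (auto simp: m)
  then obtain z where "{p, q, r} - m = {z}" by (auto simp: card_1_singleton_iff)
  then have "{p, q, r} = {x, y, z}" "y \<noteq> z" "x \<noteq> z" using assms(2) m by blast+
  then show ?thesis using that m by blast
qed

lemma conjugated_point_in_drawing:
  assumes "conjugated_triangulation L H" "e \<in> edges L" shows "point H e \<in> drawing L"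
  using assms curve_half_in_path_image[of L e] edge_subset_drawing[of e L]
  by (auto simp: conjugated_triangulation_def)

text \<open>Passes from the combinatorial condition to topology: the three boundary edges form a
  Jordan curve, and boundedness excludes its outside.\<close>

lemma triangular_face_eq_inside:
  assumes L: "plane_graph L" and f: "f \<in> bounded_faces L" and "triangular_face L f"
  obtains p q r where "p \<noteq> q" "q \<noteq> r" "p \<noteq> r" "boundary_edges L f = {p, q, r}"
    "jordan_curve (frontier f)" "f = inside (frontier f)"
proof -
  obtain a b c where abc: "a \<noteq> b" "b \<noteq> c" "a \<noteq> c" "boundary_edges L f = {{a, b}, {b, c}, {a, c}}"
    "frontier f = (\<Union>e\<in>boundary_edges L f. path_image (curve L e))"
    using assms(3) by (auto simp: triangular_face_def)
  have "{{a, b}, {b, c}, {a, c}} \<subseteq> edges L" using abc(4) by (auto simp: boundary_edges_def)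
  then have j: "jordan_curve (frontier f)"
    using triangle_jordan[OF L, of a b c] abc by (simp add: triangle_def Un_assoc)
  moreover have "f = inside (frontier f)"
    using bounded_component_eq_inside[OF _ closed_drawing[OF L] _ refl j] f
    by (auto simp: bounded_faces_def faces_def)
  moreover have "{a, b} \<noteq> {b, c}" "{b, c} \<noteq> {a, c}" "{a, b} \<noteq> {a, c}"
    using abc(1-3) by (auto simp: doubleton_eq_iff)
  ultimately show ?thesis using that[OF _ _ _ abc(4)] by metis
qed

section \<open>Faces at a common median\<close>

theorem second_class_faces_common_edge_eq:
  assumes L: "plane_graph L" and LH: "conjugated_triangulation L H"
    and F: "F \<in> second_class_faces L H" and G: "G \<in> second_class_faces L H"
    and m: "m \<in> boundary_edges H F" "m \<in> boundary_edges H G"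
  shows "F = G"
proof -
  have H: "plane_graph H" and vH: "verts H = edges L"
    and eH: "edges H = {m. card m = 2 \<and> (\<exists>f\<in>bounded_faces L. m \<subseteq> boundary_edges L f)}"
    and median: "\<And>f m. f \<in> bounded_faces L \<Longrightarrow> card m = 2 \<Longrightarrow> m \<subseteq> boundary_edges L f \<Longrightarrow>
      path_image (curve H m) \<subseteq> f \<union> point H ` m"
    using LH by (auto simp: conjugated_triangulation_def)
  obtain f where f: "f \<in> bounded_faces L" "m \<subseteq> boundary_edges L f" "card m = 2"
    using m eH by (auto simp: boundary_edges_def)
  have "triangular_face L f" using LH f(1) by (auto simp: conjugated_triangulation_def)
  from triangular_face_eq_inside[OF L f(1) this]
  obtain p q r where pqr: "p \<noteq> q" "q \<noteq> r" "p \<noteq> r" "boundary_edges L f = {p, q, r}"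
    and J: "jordan_curve (frontier f)" and fin: "f = inside (frontier f)" .
  have "m \<subseteq> {p, q, r}" using f(2) pqr(4) by simp
  from card_2_in_triple[OF f(3) this pqr(1-3)]
  obtain x y z where xyz: "m = {x, y}" "boundary_edges L f = {x, y, z}" "x \<noteq> y" "y \<noteq> z" "x \<noteq> z"
    unfolding pqr(4) .
  have inL: "x \<in> edges L" "y \<in> edges L" "z \<in> edges L"
    using xyz(2) by (auto simp: boundary_edges_def)
  have onJ: "point H e \<in> frontier f" if "e \<in> boundary_edges L f" for e
    using that LH curve_half_in_path_image[of L e]
    by (auto simp: conjugated_triangulation_def boundary_edges_def)
  have inj: "inj_on (point H) (edges L)" using H vH by (simp add: plane_graph_def)
  have "k \<in> edges H" if "card k = 2" "k \<subseteq> boundary_edges L f" for k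
    using eH f(1) that by blast
  then have E: "{x, y} \<in> edges H" "{y, z} \<in> edges H" "{z, x} \<in> edges H"
    using xyz(2-5) by simp_all
  have med: "edge_image H u v - {point H u, point H v} \<subseteq> inside (frontier f)"
    if "{u, v} \<subseteq> {x, y, z}" "u \<noteq> v" for u v
    using median[OF f(1), of "{u, v}"] that xyz(2) unfolding fin[symmetric] by auto
  let ?K = "edge_image H x y" and ?K1 = "edge_image H y z" and ?K2 = "edge_image H z x"
  let ?T = "inside (?K \<union> ?K1 \<union> ?K2)"
  obtain C where C: "connected C" "C \<subseteq> inside (frontier f)" "C \<inter> (?K \<union> ?K1 \<union> ?K2) = {}"
    and nb: "\<And>p. p \<in> ?K - {point H x, point H y} \<Longrightarrow> \<exists>U. open U \<and> p \<in> U \<and> U \<subseteq> C \<union> ?T \<union> ?K"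
    and T: "jordan_curve (?K \<union> ?K1 \<union> ?K2)" "?T \<subseteq> inside (frontier f)"
  proof (rule medial_triangle_nbhd[OF J, of "point H x" "point H y" "point H z" ?K ?K1 ?K2])
    show "point H x \<in> frontier f" "point H y \<in> frontier f" "point H z \<in> frontier f"
      using onJ xyz(2) by auto
    show "point H x \<noteq> point H y" "point H y \<noteq> point H z" "point H x \<noteq> point H z"
      using inj inL xyz(3-5) by (auto dest: inj_onD)
    show "?K \<inter> ?K2 = {point H x}"
      using edge_image_Int[OF H E(3,1)] xyz(4) by (simp add: Int_commute)
  qed (use med plane_graph_arc[OF H] E edge_image_Int[OF H] xyz(3-5) in auto)
  have f_drawing: "f \<inter> drawing L = {}"
    using f(1) in_components_subset by (fastforce simp: bounded_faces_def faces_def)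
  \<comment> \<open>A median of another bounded face stays in that face except for its ends, which
    lie on the drawing of \<open>L\<close>. So \<open>f\<close> meets no medians but its own
    three.\<close>
  have "f \<inter> path_image (curve H k) \<subseteq> ?K \<union> ?K1 \<union> ?K2" if k: "k \<in> edges H" for k
  proof -
    obtain g where g: "g \<in> bounded_faces L" "k \<subseteq> boundary_edges L g" "card k = 2"
      using k eH by auto
    show ?thesis
    proof (cases "g = f")
      case True
      obtain u v where k2: "k = {u, v}" "u \<noteq> v" using g(3) by (auto simp: card_2_iff)
      then have "u = x \<or> u = y \<or> u = z" "v = x \<or> v = y \<or> v = z"
        using g(2) True xyz(2) by auto
      then have "k = {x, y} \<or> k = {y, z} \<or> k = {z, x}"
        using k2 by (metis insert_commute)
      then show ?thesis by blast
    next
      case False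
      then have "f \<inter> g = {}"
        using f(1) g(1) components_nonoverlap by (auto simp: bounded_faces_def faces_def)
      moreover have "f \<inter> point H ` k = {}"
        using conjugated_point_in_drawing[OF LH] g(2) f_drawing by (auto simp: boundary_edges_def)
      ultimately show ?thesis using median[OF g(1,3,2)] by blast
    qed
  qed
  moreover have "f \<inter> point H ` verts H = {}"
    using conjugated_point_in_drawing[OF LH] f_drawing vH by auto
  ultimately have fD: "f \<inter> drawing H \<subseteq> ?K \<union> ?K1 \<union> ?K2" by (auto simp: drawing_def)
  have CD: "C \<subseteq> - drawing H" using C(2,3) fD unfolding fin[symmetric] by blast
  have TD: "?T \<inter> drawing H = {}" using T(2) fD inside_no_overlap[of "?K \<union> ?K1 \<union> ?K2"]
    unfolding fin[symmetric] by blast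
  have MD: "?K \<union> ?K1 \<union> ?K2 \<subseteq> drawing H" using E by (simp add: edge_subset_drawing)
  \<comment> \<open>It is enough that every such face contains the nonempty corner \<open>C\<close>:
    two components with a common point are equal.\<close>
  have key: "C \<noteq> {} \<and> C \<subseteq> F'" if F': "F' \<in> second_class_faces L H" "m \<in> boundary_edges H F'" for F'
  proof -
    have comp: "F' \<in> components (- drawing H)"
      using F'(1) by (auto simp: second_class_faces_def bounded_faces_def faces_def)
    let ?p = "curve H m (1/2)"
    have "?p \<in> ?K - {point H x, point H y}"
      using curve_half_notin_ends[OF H E(1)] curve_half_in_path_image[of H m] xyz(1) by simp
    then obtain U where U: "open U" "?p \<in> U" "U \<subseteq> C \<union> ?T \<union> ?K" using nb by blast
    have "?p \<in> closure F'"
      using F'(2) curve_half_in_path_image[of H m] by (auto simp: boundary_edges_def frontier_def)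
    then obtain q where q: "q \<in> F'" "q \<in> U"
      using U(1,2) by (meson closure_iff_nhds_not_empty disjoint_iff subset_refl)
    \<comment> \<open>The medial triangle is drawn in \<open>H\<close>, so a face meeting its inside
      is trapped there. But that inside is part of \<open>f\<close> and contains no vertex of
      \<open>L\<close>, contrary to the second class.\<close>
    have "F' \<inter> ?T = {}"
    proof (rule ccontr)
      assume ne: "F' \<inter> ?T \<noteq> {}"
      have "F' \<subseteq> ?T"
        by (rule frontier_subset_component[OF comp _ ne])
          (use jordan_curve_props(7)[OF T(1)] MD in simp)
      moreover obtain v where "v \<in> verts L" "point L v \<in> F'"
        using F'(1) interior_subset by (auto simp: second_class_faces_def)
      ultimately show False using T(2) f_drawing unfolding fin[symmetric] by (auto simp: drawing_def)
    qed
    moreover have "q \<notin> ?K" using q(1) in_components_subset[OF comp] MD by blast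
    ultimately have "q \<in> C" using q U(3) by blast
    then show ?thesis using components_maximal[OF comp C(1) CD] q(1) by blast
  qed
  have "F \<inter> G \<noteq> {}" using key[OF F m(1)] key[OF G m(2)] by blast
  then show ?thesis
    using F G components_nonoverlap[of F "- drawing H" G]
    by (auto simp: second_class_faces_def bounded_faces_def faces_def)
qed

section \<open>Non-planarity of the complete graph on five vertices\<close>

lemma edge_image_disjoint:
  assumes "plane_graph G" "{a, b} \<in> edges G" "{c, d} \<in> edges G" "{a, b} \<inter> {c, d} = {}"
  shows "edge_image G a b \<inter> edge_image G c d = {}"
proof -
  have "{a, b} \<noteq> {c, d}" using assms(4) by auto
  then show ?thesis using plane_graph_Int[OF assms(1-3)] assms(4) by simp
qed

lemma vertex_in_edge_image:
  assumes "plane_graph G" "v \<in> verts G" "e \<in> edges G" "point G v \<in> path_image (curve G e)"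
  shows "v \<in> e"
proof -
  have "point G v \<in> point G ` e" using assms unfolding plane_graph_def by blast
  moreover have "inj_on (point G) (verts G)" using assms(1) by (simp add: plane_graph_def)
  ultimately show ?thesis using plane_graph_edge(1)[OF assms(1,3)] assms(2)
    by (metis inj_on_image_mem_iff)
qed

text \<open>Two theta splittings. The path from \<open>a\<close> over \<open>d\<close> to
  \<open>b\<close> is a chord of the outer triangle and cuts off \<open>?P\<close>; the arc from
  \<open>c\<close> to \<open>d\<close> is then a chord of the remaining quadrangle \<open>?W\<close>
  and cuts it into \<open>?Q\<close> and \<open>?R\<close>.\<close>

lemma K4_split_arcs:
  assumes AB: "arc_between AB a b" and BC: "arc_between BC b c" and AC: "arc_between AC a c"
    and AD: "arc_between AD a d" and BD: "arc_between BD b d" and CD: "arc_between CD c d"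
    and i: "AB \<inter> BC = {b}" "AB \<inter> AC = {a}" "AB \<inter> AD = {a}" "AB \<inter> BD = {b}" "AB \<inter> CD = {}"
      "BC \<inter> AC = {c}" "BC \<inter> AD = {}" "BC \<inter> BD = {b}" "BC \<inter> CD = {c}"
      "AC \<inter> AD = {a}" "AC \<inter> BD = {}" "AC \<inter> CD = {c}"
      "AD \<inter> BD = {d}" "AD \<inter> CD = {d}" "BD \<inter> CD = {d}"
    and d: "d \<in> inside (AB \<union> BC \<union> AC)"
  shows "inside (AB \<union> BC \<union> AC) = inside (AB \<union> BD \<union> AD) \<union> inside (BC \<union> CD \<union> BD)
      \<union> inside (AC \<union> CD \<union> AD) \<union> (AD - {a}) \<union> (BD - {b}) \<union> (CD - {c})"
    and "inside (AB \<union> BD \<union> AD) \<inter> inside (BC \<union> CD \<union> BD) = {}"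
    and "inside (AB \<union> BD \<union> AD) \<inter> inside (AC \<union> CD \<union> AD) = {}"
    and "inside (BC \<union> CD \<union> BD) \<inter> inside (AC \<union> CD \<union> AD) = {}"
    and "(inside (AB \<union> BD \<union> AD) \<union> inside (BC \<union> CD \<union> BD) \<union> inside (AC \<union> CD \<union> AD)) \<inter> (AD \<union> BD \<union> CD) = {}"
proof -
  note ends = arc_between_ends[OF AB] arc_between_ends[OF BC] arc_between_ends[OF AC]
    arc_between_ends[OF AD] arc_between_ends[OF BD] arc_between_ends[OF CD]
  have j: "jordan_curve (AB \<union> (AC \<union> BC))"
    using jordan_curve_Un[OF AB arc_between_join[OF AC arc_between_sym[OF BC]]] i
    by (simp add: Int_Un_distrib Int_Un_distrib2 Int_commute insert_commute)
  have A2: "arc_between (AC \<union> BC) a b"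
    using arc_between_join[OF AC arc_between_sym[OF BC]] i by (simp add: Int_commute)
  have A3: "arc_between (AD \<union> BD) a b"
    using arc_between_join[OF AD arc_between_sym[OF BD]] i by simp
  have i1: "AB \<inter> (AC \<union> BC) = {a, b}" "AB \<inter> (AD \<union> BD) = {a, b}" "(AC \<union> BC) \<inter> (AD \<union> BD) = {a, b}"
    using i by (simp_all add: Int_Un_distrib Int_Un_distrib2 insert_commute)
  have e1: "AB \<union> (AC \<union> BC) = AB \<union> BC \<union> AC" "AB \<union> (AD \<union> BD) = AB \<union> BD \<union> AD" by blast+
  let ?W = "inside (AC \<union> BC \<union> (AD \<union> BD))"
  let ?X = "inside (AB \<union> BC \<union> AC)" and ?P = "inside (AB \<union> BD \<union> AD)"
  let ?Q = "inside (BC \<union> CD \<union> BD)" and ?R = "inside (AC \<union> CD \<union> AD)"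
  have "d \<in> (AD \<union> BD) \<inter> inside (AB \<union> (AC \<union> BC))" using d ends(11) e1(1) by simp
  then have ne1: "(AD \<union> BD) \<inter> inside (AB \<union> (AC \<union> BC)) \<noteq> {}" by blast
  note s1 = theta_split[OF AB A2 A3 i1 ne1, unfolded e1]
  have jP: "jordan_curve (AB \<union> BD \<union> AD)" and jW: "jordan_curve (AC \<union> BC \<union> (AD \<union> BD))"
    using jordan_curve_Un[OF AB A3 i1(2)] jordan_curve_Un[OF A2 A3 i1(3)] e1 by auto
  \<comment> \<open>Only \<open>d\<close> is known to be inside. Without its end \<open>c\<close>
    the arc is connected and misses the outer triangle, so all of it is inside.\<close>
  have cd_in: "CD - {c} \<subseteq> ?X"
  proof (rule connected_subset_inside)
    show "jordan_curve (AB \<union> BC \<union> AC)" using j e1(1) by simp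
    show "connected (CD - {c})"
      by (rule arc_between_connected_diff[OF arc_between_sym[OF CD]])
    show "(CD - {c}) \<inter> (AB \<union> BC \<union> AC) = {}" using i(5,9,12) by blast
    show "(CD - {c}) \<inter> ?X \<noteq> {}" using d ends(17,18) by blast
  qed
  have "c \<notin> ?X" using inside_no_overlap[of "AB \<union> BC \<union> AC"] ends(5) by blast
  moreover have "?P \<subseteq> ?X" using s1(2) by blast
  moreover have "c \<notin> AB" "c \<notin> BD" "c \<notin> AD"
    using i(5,14,15) ends(16,18) by blast+
  \<comment> \<open>\<open>c\<close> is the end that places \<open>CD\<close>: being off the closure
    of \<open>?P\<close>, it forces the arc into the quadrangle \<open>?W\<close>.\<close>
  ultimately have "c \<notin> ?P \<union> (AB \<union> BD \<union> AD)" by blast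
  moreover have "(CD - {c, d}) \<inter> (AD \<union> BD - {a, b}) = {}" using i(14,15) by blast
  moreover have "CD - {c, d} \<subseteq> ?X" using cd_in by blast
  ultimately have cdW: "CD - {c, d} \<subseteq> ?W"
    using arc_in_theta_side[OF equalityD1[OF s1(2)] jP jW s1(1) CD] by blast

  \<comment> \<open>The quadrangle is now read as two arcs between its opposite corners
    \<open>c\<close> and \<open>d\<close>, one through \<open>a\<close> and one through
    \<open>b\<close>.\<close>
  have B1: "arc_between (AC \<union> AD) c d"
    using arc_between_join[OF arc_between_sym[OF AC] AD] i by simp
  have B2: "arc_between (BC \<union> BD) c d"
    using arc_between_join[OF arc_between_sym[OF BC] BD] i by simp
  have "AC \<inter> BC = {c}" "AD \<inter> BC = {}" using i(6,7) by (simp_all add: Int_commute)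
  then have i2: "(AC \<union> AD) \<inter> (BC \<union> BD) = {c, d}" "(AC \<union> AD) \<inter> CD = {c, d}" "(BC \<union> BD) \<inter> CD = {c, d}"
    using i by (simp_all add: Int_Un_distrib Int_Un_distrib2 insert_commute)
  have e2: "AC \<union> AD \<union> (BC \<union> BD) = AC \<union> BC \<union> (AD \<union> BD)" "AC \<union> AD \<union> CD = AC \<union> CD \<union> AD"
    "BC \<union> BD \<union> CD = BC \<union> CD \<union> BD" by blast+
  have ne2: "CD \<inter> inside (AC \<union> AD \<union> (BC \<union> BD)) \<noteq> {}"
    unfolding e2 using cdW arc_between_connected_endless(2)[OF CD] by blast
  note s2 = theta_split[OF B1 B2 CD i2 ne2, unfolded e2]
  have "AD \<union> BD - {a, b} = (AD - {a}) \<union> (BD - {b})" using i(3,4,7,10,11) ends(1,2,4,7) by blast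
  moreover have "(CD - {c, d}) \<union> (AD - {a}) = (CD - {c}) \<union> (AD - {a})"
    using ends(11,12) by blast
  ultimately show "?X = ?P \<union> ?Q \<union> ?R \<union> (AD - {a}) \<union> (BD - {b}) \<union> (CD - {c})"
    unfolding s1(2) s2(2) by blast
  show PQ: "?P \<inter> ?Q = {}" "?P \<inter> ?R = {}" "?Q \<inter> ?R = {}" using s1(1) s2 by blast+
  have WX: "?W \<inter> (AD \<union> BD) = {}" using inside_no_overlap[of "AC \<union> BC \<union> (AD \<union> BD)"] by blast
  have "c \<notin> ?P" using \<open>c \<notin> ?P \<union> (AB \<union> BD \<union> AD)\<close> by blast
  moreover have "?P \<inter> (AD \<union> BD) = {}" using inside_no_overlap[of "AB \<union> BD \<union> AD"] by blast
  moreover have "?P \<inter> (CD - {c, d}) = {}" using cdW s1(1) by blast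
  ultimately have "?P \<inter> (AD \<union> BD \<union> CD) = {}" using ends(11) by blast
  moreover have "?Q \<inter> CD = {}" "?R \<inter> CD = {}"
    using inside_no_overlap[of "BC \<union> CD \<union> BD"] inside_no_overlap[of "AC \<union> CD \<union> AD"] by blast+
  moreover have "?Q \<subseteq> ?W" "?R \<subseteq> ?W" using s2(2) by blast+
  ultimately show "(?P \<union> ?Q \<union> ?R) \<inter> (AD \<union> BD \<union> CD) = {}" using WX by blast
qed

text \<open>The fifteen intersection hypotheses on the six arcs become instances of the rule that
  edges meet exactly in common vertices. The rules \<open>I\<close> and \<open>I'\<close> cover the
  orders in which a shared vertex can be written.\<close>

lemma K4_split:
  assumes G: "plane_graph G" and "distinct [a, b, c, d]"
    and E: "{a, b} \<in> edges G" "{b, c} \<in> edges G" "{a, c} \<in> edges G"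
      "{a, d} \<in> edges G" "{b, d} \<in> edges G" "{c, d} \<in> edges G"
    and d: "point G d \<in> inside (triangle G a b c)"
  shows "inside (triangle G a b c) = inside (triangle G a b d) \<union> inside (triangle G b c d)
      \<union> inside (triangle G a c d) \<union> (edge_image G a d - {point G a})
      \<union> (edge_image G b d - {point G b}) \<union> (edge_image G c d - {point G c})"
    and "inside (triangle G a b d) \<inter> inside (triangle G b c d) = {}"
    and "inside (triangle G a b d) \<inter> inside (triangle G a c d) = {}"
    and "inside (triangle G b c d) \<inter> inside (triangle G a c d) = {}"
    and "(inside (triangle G a b d) \<union> inside (triangle G b c d) \<union> inside (triangle G a c d))
      \<inter> (edge_image G a d \<union> edge_image G b d \<union> edge_image G c d) = {}"
proof -
  have I: "edge_image G x y \<inter> edge_image G x z = {point G x}"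
    if "{x, y} \<in> edges G" "{x, z} \<in> edges G" "y \<noteq> z" for x y z
    using edge_image_Int[OF G, of y x z] that by (simp add: insert_commute)
  have I': "edge_image G y x \<inter> edge_image G z x = {point G x}"
    "edge_image G y x \<inter> edge_image G x z = {point G x}"
    "edge_image G x y \<inter> edge_image G z x = {point G x}"
    if "{x, y} \<in> edges G" "{x, z} \<in> edges G" "y \<noteq> z" for x y z
    using I[OF that] by (simp_all add: insert_commute)
  have E': "{b, a} \<in> edges G" "{c, b} \<in> edges G" "{c, a} \<in> edges G"
      "{d, a} \<in> edges G" "{d, b} \<in> edges G" "{d, c} \<in> edges G"
    using E by (simp_all add: insert_commute)
  have dist: "a \<noteq> b" "b \<noteq> a" "a \<noteq> c" "c \<noteq> a" "a \<noteq> d" "d \<noteq> a" "b \<noteq> c" "c \<noteq> b"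
    "b \<noteq> d" "d \<noteq> b" "c \<noteq> d" "d \<noteq> c" using assms(2) by auto
  note * = K4_split_arcs[OF plane_graph_arc[OF G E(1)] plane_graph_arc[OF G E(2)]
      plane_graph_arc[OF G E(3)] plane_graph_arc[OF G E(4)] plane_graph_arc[OF G E(5)]
      plane_graph_arc[OF G E(6)] _ _ _ _ _ _ _ _ _ _ _ _ _ _ _ d[unfolded triangle_def],
      folded triangle_def]
  show "inside (triangle G a b c) = inside (triangle G a b d) \<union> inside (triangle G b c d)
      \<union> inside (triangle G a c d) \<union> (edge_image G a d - {point G a})
      \<union> (edge_image G b d - {point G b}) \<union> (edge_image G c d - {point G c})"
    "inside (triangle G a b d) \<inter> inside (triangle G b c d) = {}"
    "inside (triangle G a b d) \<inter> inside (triangle G a c d) = {}"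
    "inside (triangle G b c d) \<inter> inside (triangle G a c d) = {}"
    "(inside (triangle G a b d) \<union> inside (triangle G b c d) \<union> inside (triangle G a c d))
      \<inter> (edge_image G a d \<union> edge_image G b d \<union> edge_image G c d) = {}"
    by (rule *; use dist E E' in \<open>simp add: I I' edge_image_disjoint[OF G]\<close>)+
qed

lemma edge_avoids_triangle:
  assumes G: "plane_graph G" and E: "{a, b} \<in> edges G" "{b, c} \<in> edges G" "{a, c} \<in> edges G"
    and e: "e \<in> edges G" "e \<inter> {a, b, c} = {}"
  shows "path_image (curve G e) \<inter> triangle G a b c = {}"
proof -
  have "e \<noteq> {a, b}" "e \<noteq> {b, c}" "e \<noteq> {a, c}" using e(2) by auto
  then have "path_image (curve G e) \<inter> edge_image G a b = point G ` (e \<inter> {a, b})"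
    "path_image (curve G e) \<inter> edge_image G b c = point G ` (e \<inter> {b, c})"
    "path_image (curve G e) \<inter> edge_image G a c = point G ` (e \<inter> {a, c})"
    using plane_graph_Int[OF G e(1)] E by blast+
  moreover have "e \<inter> {a, b} = {}" "e \<inter> {b, c} = {}" "e \<inter> {a, c} = {}" using e(2) by blast+
  ultimately show ?thesis by (simp add: triangle_def Int_Un_distrib)
qed

text \<open>The edge shares no vertex with the triangle, so it cannot touch it and stays on the side
  of its first end.\<close>

lemma edge_inside_triangle:
  assumes G: "plane_graph G" and E: "{a, b} \<in> edges G" "{b, c} \<in> edges G" "{a, c} \<in> edges G"
    and "distinct [a, b, c, u, v]" "{u, v} \<in> edges G" "point G u \<in> inside (triangle G a b c)"
  shows "point G v \<in> inside (triangle G a b c)"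
proof -
  note A = plane_graph_arc[OF G \<open>{u, v} \<in> edges G\<close>]
  have "edge_image G u v \<subseteq> inside (triangle G a b c)"
  proof (rule connected_subset_inside)
    show "jordan_curve (triangle G a b c)" using triangle_jordan[OF G E] assms(5) by simp
    show "connected (edge_image G u v)"
      using A connected_arc_image unfolding arc_between_def by metis
    show "edge_image G u v \<inter> triangle G a b c = {}"
      by (rule edge_avoids_triangle[OF G E]) (use assms(5,6) in auto)
    show "edge_image G u v \<inter> inside (triangle G a b c) \<noteq> {}"
      using arc_between_ends(1)[OF A] assms(7) by blast
  qed
  then show ?thesis using arc_between_ends(2)[OF A] by blast
qed

text \<open>Each of the three small triangles at \<open>d\<close> omits one of \<open>a\<close>,
  \<open>b\<close>, \<open>c\<close>. If \<open>e\<close> is inside one of them, its edge to the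
  omitted vertex pulls that vertex into the inside of the outer triangle, on whose boundary it
  lies.\<close>

lemma no_K5_vertex_inside:
  assumes G: "plane_graph G" and "distinct [a, b, c, d, e]"
    and E: "\<And>x y. x \<in> {a, b, c, d, e} \<Longrightarrow> y \<in> {a, b, c, d, e} \<Longrightarrow> x \<noteq> y \<Longrightarrow> {x, y} \<in> edges G"
  shows "point G d \<notin> inside (triangle G a b c)"
proof
  assume d: "point G d \<in> inside (triangle G a b c)"
  have E': "{x, y} \<in> edges G" if "x \<in> {a, b, c, d, e}" "y \<in> {a, b, c, d, e}" "x \<noteq> y" for x y
    by (rule E[OF that])
  have V: "v \<in> verts G" if "v \<in> {a, b, c, d, e}" for v
  proof -
    obtain w where "w \<in> {a, b, c, d, e}" "v \<noteq> w" using that assms(2) by auto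
    then show ?thesis using plane_graph_edge(1)[OF G E'[OF that]] by blast
  qed
  have dist: "a \<noteq> b" "a \<noteq> c" "a \<noteq> d" "a \<noteq> e" "b \<noteq> c" "b \<noteq> d" "b \<noteq> e" "c \<noteq> d" "c \<noteq> e" "d \<noteq> e"
    using assms(2) by auto
  have e: "point G e \<in> inside (triangle G a b c)"
    by (rule edge_inside_triangle[OF G _ _ _ _ _ d]) (use dist in \<open>simp_all add: E'\<close>)
  have off: "point G e \<notin> edge_image G x d" if "x \<in> {a, b, c}" for x
    using vertex_in_edge_image[OF G V[of e] E'[of x d]] that dist by auto
  have split: "inside (triangle G a b c) = inside (triangle G a b d) \<union> inside (triangle G b c d)
      \<union> inside (triangle G a c d) \<union> (edge_image G a d - {point G a})
      \<union> (edge_image G b d - {point G b}) \<union> (edge_image G c d - {point G c})"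
    by (rule K4_split(1)[OF G _ _ _ _ _ _ _ d]) (use dist in \<open>simp_all add: E'\<close>)
  have on: "point G a \<in> triangle G a b c" "point G b \<in> triangle G a b c" "point G c \<in> triangle G a b c"
    using arc_between_ends(1,2)[OF plane_graph_arc[OF G E'[of a b]]]
      arc_between_ends(1,2)[OF plane_graph_arc[OF G E'[of b c]]] dist by (auto simp: triangle_def)
  have no: "point G v \<notin> inside (triangle G a b c)" if "v \<in> {a, b, c}" for v
    using on that inside_no_overlap[of "triangle G a b c"] by blast
  consider "point G e \<in> inside (triangle G a b d)" | "point G e \<in> inside (triangle G b c d)"
    | "point G e \<in> inside (triangle G a c d)" using e off[of a] off[of b] off[of c] unfolding split by blast
  then show False
  proof cases
    case 1
    have "point G c \<in> inside (triangle G a b d)"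
      by (rule edge_inside_triangle[OF G _ _ _ _ _ 1]) (use dist in \<open>simp_all add: E'\<close>)
    then show ?thesis using no[of c] split by blast
  next
    case 2
    have "point G a \<in> inside (triangle G b c d)"
      by (rule edge_inside_triangle[OF G _ _ _ _ _ 2]) (use dist in \<open>simp_all add: E'\<close>)
    then show ?thesis using no[of a] split by blast
  next
    case 3
    have "point G b \<in> inside (triangle G a c d)"
      by (rule edge_inside_triangle[OF G _ _ _ _ _ 3]) (use dist in \<open>simp_all add: E'\<close>)
    then show ?thesis using no[of b] split by blast
  qed
qed

text \<open>If the image of \<open>d\<close> were outside, the outside of the image curve, without
  \<open>0\<close>, would be a connected set that \<open>\<psi>\<close> maps off \<open>J\<close>.
  Its image would contain \<open>d\<close> and, coming from points of large norm, points near
  \<open>w\<close>; so \<open>d\<close> would be inside \<open>J\<close>.\<close>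

lemma inversion_outside_to_inside:
  fixes w :: complex
  defines "\<phi> \<equiv> \<lambda>z. inverse (z - w)"
  assumes J: "jordan_curve J" "jordan_curve (\<phi> ` J)" and w: "w \<in> inside J" and d: "d \<in> outside J"
  shows "\<phi> d \<in> inside (\<phi> ` J)"
proof (rule ccontr)
  assume "\<phi> d \<notin> inside (\<phi> ` J)"
  define \<psi> where "\<psi> = (\<lambda>u. w + inverse u)"
  \<comment> \<open>True even for \<open>z = w\<close>, because
    \<open>inverse 0 = 0\<close>.\<close>
  have \<psi>\<phi>: "\<psi> (\<phi> z) = z" for z by (simp add: \<psi>_def \<phi>_def)
  have \<phi>\<psi>: "\<phi> (\<psi> z) = z" for z by (simp add: \<psi>_def \<phi>_def)
  have "d \<notin> J" "d \<notin> inside J" using d outside_no_overlap[of J] inside_Int_outside[of J] by blast+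
  then have "d \<noteq> w" using w by blast
  have "\<phi> d \<notin> \<phi> ` J" using \<open>d \<notin> J\<close> \<psi>\<phi> by (metis imageE)
  \<comment> \<open>\<open>0\<close> stands for the image of infinity and is where
    \<open>\<psi>\<close> is discontinuous. Deleting one point leaves an open connected set in the
    plane connected.\<close>
  define V where "V = outside (\<phi> ` J) - {0}"
  have "\<phi> d \<in> outside (\<phi> ` J)"
    using \<open>\<phi> d \<notin> inside (\<phi> ` J)\<close> \<open>\<phi> d \<notin> \<phi> ` J\<close> inside_Un_outside[of "\<phi> ` J"] by blast
  then have "\<phi> d \<in> V" using \<open>d \<noteq> w\<close> by (simp add: V_def \<phi>_def)
  have "connected V"
    unfolding V_def using jordan_curve_props(8,9)[OF J(2)]
    by (intro connected_open_delete) (auto simp: DIM_complex)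
  moreover have "continuous_on V \<psi>" unfolding V_def \<psi>_def by (auto intro!: continuous_intros)
  ultimately have "connected (\<psi> ` V)" by (rule connected_continuous_image[rotated])
  moreover have "\<psi> ` V \<inter> J = {}"
  proof -
    have "\<psi> u \<notin> J" if "u \<in> V" for u
    proof
      assume "\<psi> u \<in> J"
      then have "u \<in> \<phi> ` J" using imageI[of "\<psi> u" J \<phi>] \<phi>\<psi>[of u] by simp
      then show False using that outside_no_overlap[of "\<phi> ` J"] unfolding V_def by blast
    qed
    then show ?thesis by blast
  qed
  moreover have "\<psi> ` V \<inter> inside J \<noteq> {}"
  proof -
    \<comment> \<open>The outside is unbounded, so it has a point \<open>u\<close> with norm above
      \<open>inverse r\<close>; \<open>\<psi>\<close> brings it closer than \<open>r\<close> to
      \<open>w\<close>.\<close>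
    obtain r where r: "r > 0" "ball w r \<subseteq> inside J"
      using jordan_curve_props(4)[OF J(1)] w by (auto simp: open_contains_ball)
    obtain u where u: "u \<in> outside (\<phi> ` J)" "norm u > inverse r"
      using jordan_curve_props(10)[OF J(2)] unfolding bounded_iff by (meson not_le)
    have "norm u > 0" using u(2) r(1) by (meson inverse_positive_iff_positive less_trans)
    then have "u \<in> V" using u(1) by (auto simp: V_def)
    moreover have "norm (inverse u) < r"
      using u(2) r(1) \<open>norm u > 0\<close> by (simp add: norm_divide field_simps)
    then have "\<psi> u \<in> ball w r" by (simp add: \<psi>_def dist_norm)
    ultimately show ?thesis using r(2) by blast
  qed
  ultimately have "\<psi> ` V \<subseteq> inside J" by (rule connected_subset_inside[OF J(1)])
  then show False using \<open>\<phi> d \<in> V\<close> \<psi>\<phi> \<open>d \<notin> inside J\<close> by (metis image_subset_iff)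
qed

text \<open>Apart from the arc property, the conditions concern intersections of subsets of the
  drawing, which an injective map preserves; continuity keeps the arcs. Both are required only on
  the drawing, so the map may have a pole elsewhere.\<close>

lemma plane_graph_image:
  assumes G: "plane_graph G" and inj: "inj_on \<phi> (drawing G)" and cont: "continuous_on (drawing G) \<phi>"
  shows "plane_graph (G\<lparr>point := \<phi> \<circ> point G, curve := \<lambda>e. \<phi> \<circ> curve G e\<rparr>)"
proof -
  have P: "point G ` S \<subseteq> drawing G" if "S \<subseteq> verts G" for S using that by (auto simp: drawing_def)
  have Q: "path_image (curve G e) \<subseteq> drawing G" if "e \<in> edges G" for e
    by (rule edge_subset_drawing[OF that])
  have img: "path_image (\<phi> \<circ> g) = \<phi> ` path_image g" for g by (rule path_image_compose)
  have arc: "arc (\<phi> \<circ> curve G e)" if "e \<in> edges G" for e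
  proof -
    have "arc (curve G e)" using G that by (auto simp: plane_graph_def)
    then show ?thesis
      unfolding arc_def using Q[OF that] inj cont
      by (auto intro!: path_continuous_image comp_inj_on
          intro: inj_on_subset continuous_on_subset simp: path_image_def)
  qed
  have ends: "{pathstart (\<phi> \<circ> curve G e), pathfinish (\<phi> \<circ> curve G e)} = \<phi> ` point G ` e"
    if "e \<in> edges G" for e
  proof -
    have "{pathstart (curve G e), pathfinish (curve G e)} = point G ` e"
      using G that by (auto simp: plane_graph_def)
    from this[symmetric] show ?thesis by (simp add: pathstart_compose pathfinish_compose)
  qed
  have meet: "\<phi> ` path_image (curve G e) \<inter> \<phi> ` point G ` verts G = \<phi> ` point G ` e" if "e \<in> edges G" for e
    using inj_on_image_Int[OF inj Q[OF that] P[OF subset_refl]] G that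
    by (auto simp: plane_graph_def)
  have Int: "\<phi> ` path_image (curve G e) \<inter> \<phi> ` path_image (curve G e') = \<phi> ` point G ` (e \<inter> e')"
    if "e \<in> edges G" "e' \<in> edges G" "e \<noteq> e'" for e e'
    using inj_on_image_Int[OF inj Q[OF that(1)] Q[OF that(2)]] plane_graph_Int[OF G that] by simp
  have "inj_on (\<phi> \<circ> point G) (verts G)"
    using G P[OF subset_refl] inj by (auto simp: plane_graph_def intro: comp_inj_on inj_on_subset)
  moreover have "simple_graph (verts G) (edges G)" using G by (simp add: plane_graph_def)
  ultimately show ?thesis
    unfolding plane_graph_def using arc ends meet Int by (simp add: img image_comp)
qed

theorem K5_not_plane:
  assumes G: "plane_graph G" and dist: "distinct [a, b, c, d, e]" and V: "verts G = {a, b, c, d, e}"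
    and E: "\<And>x y. x \<in> {a, b, c, d, e} \<Longrightarrow> y \<in> {a, b, c, d, e} \<Longrightarrow> x \<noteq> y \<Longrightarrow> {x, y} \<in> edges G"
  shows False
proof -
  let ?J = "triangle G a b c"
  have ne: "a \<noteq> b" "a \<noteq> c" "a \<noteq> d" "a \<noteq> e" "b \<noteq> c" "b \<noteq> d" "b \<noteq> e" "c \<noteq> d" "c \<noteq> e" "d \<noteq> e"
    using dist by auto
  have E3: "{a, b} \<in> edges G" "{b, c} \<in> edges G" "{a, c} \<in> edges G" using E ne by simp_all
  have J: "jordan_curve ?J" using triangle_jordan[OF G E3] ne by blast
  have "point G d \<notin> inside ?J" by (rule no_K5_vertex_inside[OF G dist E])
  moreover have "point G e \<notin> inside ?J"
    by (rule no_K5_vertex_inside[OF G _ E, where e = d]) (use dist in auto)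
  moreover have off: "point G v \<notin> ?J" if "v \<in> {d, e}" for v
    using vertex_in_edge_image[OF G _ E3(1), of v] vertex_in_edge_image[OF G _ E3(2), of v]
      vertex_in_edge_image[OF G _ E3(3), of v] that ne V by (auto simp: triangle_def)
  ultimately have out: "point G v \<in> outside ?J" if "v \<in> {d, e}" for v
    using that inside_Un_outside[of ?J] by blast
  \<comment> \<open>With \<open>d\<close> and \<open>e\<close> outside, nothing at all is drawn
    inside the triangle. Hence any point there can be the centre of the inversion, which is then
    continuous on the whole drawing.\<close>
  have edge_out: "path_image (curve G k) \<inter> inside ?J = {}" if k: "k \<in> edges G" for k
  proof (cases "k \<subseteq> {a, b, c}")
    case True
    then have "k = {a, b} \<or> k = {b, c} \<or> k = {a, c}"
      using plane_graph_edge(2)[OF G k] by (auto simp: card_2_iff)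
    then have "path_image (curve G k) \<subseteq> ?J" by (auto simp: triangle_def)
    then show ?thesis using inside_no_overlap[of ?J] by blast
  next
    case False
    then obtain u v where uv: "k = {u, v}" "u \<in> {d, e}" "u \<noteq> v"
      using plane_graph_edge(1,2)[OF G k] V by (auto simp: card_2_iff)
    have kE: "{u, v} \<in> edges G" using k uv(1) by simp
    have A: "arc_between (edge_image G u v) (point G u) (point G v)"
      by (rule plane_graph_arc[OF G kE])
    \<comment> \<open>The end \<open>u\<close> is \<open>d\<close> or \<open>e\<close> and lies
      outside. The other end may be on the triangle, so it is removed here and treated
      separately.\<close>
    have "edge_image G u v - {point G v} \<subseteq> outside ?J"
    proof (rule connected_subset_outside[OF J])
      show "connected (edge_image G u v - {point G v})" by (rule arc_between_connected_diff[OF A])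
      show "(edge_image G u v - {point G v}) \<inter> outside ?J \<noteq> {}"
        using out[OF uv(2)] arc_between_ends[OF A] by blast
      have "edge_image G u v \<inter> edge_image G p q \<subseteq> {point G v}"
        if "{p, q} \<in> edges G" "{p, q} \<subseteq> {a, b, c}" for p q
      proof -
        have "u \<notin> {p, q}" using that(2) uv(2) ne by auto
        moreover have "{u, v} \<noteq> {p, q}" using calculation by blast
        ultimately show ?thesis using plane_graph_Int[OF G kE that(1)] by auto
      qed
      then show "(edge_image G u v - {point G v}) \<inter> ?J = {}"
        using E3 unfolding triangle_def by blast
    qed
    moreover have "point G v \<notin> inside ?J"
    proof (cases "v \<in> {d, e}")
      case True
      then show ?thesis using out inside_Int_outside[of ?J] by blast
    next
      case False
      then have "v \<in> {a, b, c}" using plane_graph_edge(1)[OF G kE] V by auto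
      then have "point G v \<in> ?J"
        using arc_between_ends(1,2)[OF plane_graph_arc[OF G E3(1)]]
          arc_between_ends(1,2)[OF plane_graph_arc[OF G E3(2)]] by (auto simp: triangle_def)
      then show ?thesis using inside_no_overlap[of ?J] by blast
    qed
    ultimately show ?thesis using inside_Int_outside[of ?J] uv(1) by blast
  qed
  obtain w where w: "w \<in> inside ?J" using jordan_curve_props(3)[OF J] by blast
  have "w \<noteq> point G v" if "v \<in> {a, b, c, d, e}" for v
  proof -
    obtain u where u: "u \<in> {a, b, c, d, e}" "v \<noteq> u" using that ne by auto
    have "point G v \<in> edge_image G v u"
      by (rule arc_between_ends(1)[OF plane_graph_arc[OF G E[OF that u]]])
    then show ?thesis using edge_out[OF E[OF that u]] w by blast
  qed
  then have wD: "w \<notin> drawing G" using edge_out w V by (auto simp: drawing_def)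
  define \<phi> where "\<phi> = (\<lambda>z. inverse (z - w))"
  let ?G = "G\<lparr>point := \<phi> \<circ> point G, curve := \<lambda>e. \<phi> \<circ> curve G e\<rparr>"
  have G': "plane_graph ?G"
  proof (rule plane_graph_image[OF G])
    show "inj_on \<phi> (drawing G)" by (auto simp: inj_on_def \<phi>_def)
    show "continuous_on (drawing G) \<phi>" unfolding \<phi>_def using wD by (auto intro!: continuous_intros)
  qed
  have T: "triangle ?G a b c = \<phi> ` ?J" by (simp add: triangle_def path_image_compose image_Un)
  have "jordan_curve (\<phi> ` ?J)"
    using triangle_jordan[OF G', of a b c] E3 ne T by simp
  then have "\<phi> (point G d) \<in> inside (\<phi> ` ?J)"
    using inversion_outside_to_inside[OF J _ w out[of d]] unfolding \<phi>_def by simp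
  \<comment> \<open>The inverted drawing is again a plane complete graph, and there \<open>d\<close>
    is inside the triangle.\<close>
  moreover have "point ?G d \<notin> inside (triangle ?G a b c)"
    by (rule no_K5_vertex_inside[OF G' dist]) (use E in simp)
  ultimately show False using T by simp
qed

section \<open>Straight drawings and their medians\<close>

text \<open>An edge is an unordered pair, so \<open>SOME\<close> fixes a direction. The segment and
  its midpoint do not depend on this choice.\<close>

definition straight_curve :: "('a \<Rightarrow> complex) \<Rightarrow> 'a set \<Rightarrow> real \<Rightarrow> complex" where
  "straight_curve q e = (let uv = SOME uv. e = {fst uv, snd uv} in linepath (q (fst uv)) (q (snd uv)))"

definition straight_graph :: "'a set \<Rightarrow> 'a set set \<Rightarrow> ('a \<Rightarrow> complex) \<Rightarrow> 'a plane_graph" where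
  "straight_graph V E q = \<lparr>verts = V, edges = E, point = q, curve = straight_curve q\<rparr>"

lemma straight_graph_simps [simp]:
  "verts (straight_graph V E q) = V" "edges (straight_graph V E q) = E"
  "point (straight_graph V E q) = q" "curve (straight_graph V E q) = straight_curve q"
  by (simp_all add: straight_graph_def)

lemma straight_curve_cases:
  "straight_curve q {x, y} = linepath (q x) (q y) \<or> straight_curve q {x, y} = linepath (q y) (q x)"
proof -
  define uv where "uv = (SOME uv. {x, y} = {fst uv, snd uv})"
  have "{x, y} = {fst uv, snd uv}"
    unfolding uv_def by (rule someI[of _ "(x, y)"]) simp
  then have "uv = (x, y) \<or> uv = (y, x)" by (auto simp: doubleton_eq_iff prod_eq_iff)
  then show ?thesis by (auto simp: straight_curve_def Let_def uv_def[symmetric])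
qed

lemma path_image_straight_curve:
  "path_image (straight_curve q {x, y}) = closed_segment (q x) (q y)"
  using straight_curve_cases[of q x y] by (auto simp: closed_segment_commute)

lemma straight_curve_half: "straight_curve q {x, y} (1/2) = midpoint (q x) (q y)"
  using straight_curve_cases[of q x y]
  by (auto simp: linepath_def midpoint_def scaleR_conv_of_real algebra_simps)

text \<open>Only these inclusions carry geometric content; the reverse ones hold because each
  segment contains its ends.\<close>

lemma plane_graph_straight:
  assumes "simple_graph V E" and inj: "inj_on q V"
    and V: "\<And>e. e \<in> E \<Longrightarrow> path_image (straight_curve q e) \<inter> q ` V \<subseteq> q ` e"
    and I: "\<And>e e'. e \<in> E \<Longrightarrow> e' \<in> E \<Longrightarrow> e \<noteq> e' \<Longrightarrow>
      path_image (straight_curve q e) \<inter> path_image (straight_curve q e') \<subseteq> q ` (e \<inter> e')"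
  shows "plane_graph (straight_graph V E q)"
proof -
  have E: "arc (straight_curve q e) \<and>
      {pathstart (straight_curve q e), pathfinish (straight_curve q e)} = q ` e \<and>
      q ` e \<subseteq> path_image (straight_curve q e) \<and> e \<subseteq> V" if "e \<in> E" for e
  proof -
    have "card e = 2" "e \<subseteq> V" using assms(1) that by (auto simp: simple_graph_def)
    then obtain x y where xy: "e = {x, y}" "x \<noteq> y" "e \<subseteq> V" unfolding card_2_iff by blast
    then have "q x \<noteq> q y" using inj by (auto dest: inj_onD)
    then show ?thesis
      using straight_curve_cases[of q x y] path_image_straight_curve[of q x y] xy
      by (auto simp: arc_linepath)
  qed
  show ?thesis
    unfolding plane_graph_def straight_graph_simps
  proof (intro conjI ballI impI assms(1) inj)
    fix e e' assume *: "e \<in> E" "e' \<in> E" "e \<noteq> e'"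
    have "q ` (e \<inter> e') \<subseteq> path_image (straight_curve q e) \<inter> path_image (straight_curve q e')"
      using E[OF *(1)] E[OF *(2)] by blast
    then show "path_image (straight_curve q e) \<inter> path_image (straight_curve q e') = q ` (e \<inter> e')"
      using I[OF *] by blast
  next
    fix e assume *: "e \<in> E"
    have "q ` e \<subseteq> path_image (straight_curve q e) \<inter> q ` V" using E[OF *] by blast
    then show "path_image (straight_curve q e) \<inter> q ` V = q ` e" using V[OF *] by blast
  qed (use E in blast)+
qed

text \<open>A degenerate triangle has a hull of dimension at most one, hence without interior. So
  nondegeneracy follows from a face being nonempty and needs no coordinates.\<close>

lemma inside_triangle_nonempty_not_collinear:
  assumes "inside (closed_segment a b \<union> closed_segment b c \<union> closed_segment a c) \<noteq> ({} :: complex set)"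
  shows "\<not> collinear {a, b, c}"
proof
  assume "collinear {a, b, c}"
  then have "aff_dim (convex hull {a, b, c}) \<le> 1"
    by (simp add: collinear_aff_dim aff_dim_convex_hull)
  moreover have "interior (convex hull {a, b, c}) \<noteq> {}"
    using assms inside_of_triangle[of a b c] by (simp add: closed_segment_commute)
  ultimately show False using aff_dim_nonempty_interior[of "convex hull {a, b, c}"] by simp
qed

lemma medial_segment_subset:
  fixes a b c :: complex
  assumes "\<not> collinear {a, b, c}"
  shows "closed_segment (midpoint a b) (midpoint b c) \<subseteq>
    inside (closed_segment a b \<union> closed_segment b c \<union> closed_segment a c) \<union> {midpoint a b, midpoint b c}"
proof
  fix z assume "z \<in> closed_segment (midpoint a b) (midpoint b c)"
  then obtain u where u: "0 \<le> u" "u \<le> 1" "z = (1 - u) *\<^sub>R midpoint a b + u *\<^sub>R midpoint b c"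
    by (auto simp: closed_segment_def)
  show "z \<in> inside (closed_segment a b \<union> closed_segment b c \<union> closed_segment a c) \<union> {midpoint a b, midpoint b c}"
  proof (cases "u = 0 \<or> u = 1")
    case True
    then show ?thesis using u(3) by auto
  next
    case False
    then have "0 < (1 - u) / 2" "0 < u / 2" using u by auto
    \<comment> \<open>Barycentric coordinates of a point of the median: the shared vertex
      \<open>b\<close> always has weight one half, and the other two weights are positive strictly
      between the midpoints.\<close>
    moreover have "((1 - u) / 2) *\<^sub>R a + (1 / 2) *\<^sub>R b + (u / 2) *\<^sub>R c = z"
      unfolding u(3) by (simp add: midpoint_def scaleR_conv_of_real field_simps)
    moreover have "(1 - u) / 2 + 1 / 2 + u / 2 = 1" by (simp add: field_simps)
    ultimately have "z \<in> interior (convex hull {a, b, c})"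
      unfolding interior_convex_hull_3_minimal[OF assms DIM_complex]
      by (intro CollectI exI[of _ "(1 - u) / 2"] exI[of _ "1 / 2"] exI[of _ "u / 2"]) simp
    then show ?thesis using inside_of_triangle[of a b c] by (simp add: closed_segment_commute)
  qed
qed

text \<open>The homothety with factor -2 about the centroid maps the midpoint of each side to the
  opposite vertex.\<close>

lemma collinear_midpoints:
  fixes a b c :: complex
  assumes "collinear {midpoint a b, midpoint b c, midpoint a c}"
  shows "collinear {a, b, c}"
proof -
  have "{a, b, c} = (\<lambda>z. (a + b + c) - 2 *\<^sub>R z) ` {midpoint a b, midpoint b c, midpoint a c}"
    by (auto simp: midpoint_def scaleR_conv_of_real algebra_simps)
  obtain u where u: "\<forall>x\<in>{midpoint a b, midpoint b c, midpoint a c}.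
      \<forall>y\<in>{midpoint a b, midpoint b c, midpoint a c}. \<exists>t. x - y = t *\<^sub>R u"
    using assms unfolding collinear_def by blast
  show ?thesis
    unfolding collinear_def \<open>{a, b, c} = _\<close>
  proof (intro exI[of _ u] ballI, elim imageE)
    fix x y p q
    assume pq: "x = (a + b + c) - 2 *\<^sub>R p" "y = (a + b + c) - 2 *\<^sub>R q"
      "p \<in> {midpoint a b, midpoint b c, midpoint a c}" "q \<in> {midpoint a b, midpoint b c, midpoint a c}"
    then obtain t where "q - p = t *\<^sub>R u" using u by blast
    then have "x - y = (2 * t) *\<^sub>R u" unfolding pq(1,2)
      by (simp add: scaleR_right_diff_distrib[symmetric] flip: scaleR_scaleR)
    then show "\<exists>t. x - y = t *\<^sub>R u" by blast
  qed
qed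

text \<open>An edge drawn on the triangle has its midpoint on one of the three sides, and that
  identifies it with this side.\<close>

lemma boundary_edges_inside_triangle:
  assumes G: "plane_graph G" and E: "{a, b} \<in> edges G" "{b, c} \<in> edges G" "{a, c} \<in> edges G"
    and "a \<noteq> b" "b \<noteq> c" "a \<noteq> c"
  shows "boundary_edges G (inside (triangle G a b c)) = {{a, b}, {b, c}, {a, c}}"
    and "frontier (inside (triangle G a b c)) = triangle G a b c"
    and "triangular_face G (inside (triangle G a b c))"
proof -
  show fr: "frontier (inside (triangle G a b c)) = triangle G a b c"
    by (rule jordan_curve_props(7)[OF triangle_jordan[OF assms]])
  have "e = {a, b} \<or> e = {b, c} \<or> e = {a, c}"
    if "e \<in> edges G" "path_image (curve G e) \<subseteq> triangle G a b c" for e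
    using curve_half_in_path_image[of G e] that curve_half_in_edge[OF G that(1)] E
    unfolding triangle_def by blast
  then show BE: "boundary_edges G (inside (triangle G a b c)) = {{a, b}, {b, c}, {a, c}}"
    unfolding boundary_edges_def fr using E by (auto simp: triangle_def)
  show "triangular_face G (inside (triangle G a b c))"
    unfolding triangular_face_def BE fr using assms(5-7)
    by (intro exI[of _ a] exI[of _ b] exI[of _ c]) (auto simp: triangle_def)
qed

definition medial_graph :: "'a plane_graph \<Rightarrow> 'a set plane_graph" where
  "medial_graph L = straight_graph (edges L)
     {m. card m = 2 \<and> (\<exists>f\<in>bounded_faces L. m \<subseteq> boundary_edges L f)} (\<lambda>e. curve L e (1/2))"

definition is_straight :: "'a plane_graph \<Rightarrow> bool" where
  "is_straight L \<longleftrightarrow> (\<forall>e\<in>edges L. curve L e = straight_curve (point L) e)"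

text \<open>Each median runs inside its face, so medians of different faces can meet only in
  midpoints; medians of one face are sides of a nondegenerate medial triangle.\<close>

lemma conjugated_medial_graph:
  assumes L: "plane_graph L" and "is_straight L"
    and faces: "\<And>f. f \<in> bounded_faces L \<Longrightarrow> \<exists>a b c. a \<noteq> b \<and> b \<noteq> c \<and> a \<noteq> c \<and>
      {{a, b}, {b, c}, {a, c}} \<subseteq> edges L \<and> f = inside (triangle L a b c)"
  shows "conjugated_triangulation L (medial_graph L)"
proof -
  let ?q = "\<lambda>e. curve L e (1/2)"
  have str: "curve L e = straight_curve (point L) e" if "e \<in> edges L" for e
    using assms(2) that by (simp add: is_straight_def)
  have BE_edges: "boundary_edges L f \<subseteq> edges L" for f by (auto simp: boundary_edges_def)
  have inj: "inj_on ?q (edges L)"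
    by (rule inj_onI) (metis curve_half_in_edge[OF L] curve_half_in_path_image)
  have off: "f \<inter> ?q ` edges L = {}" if "f \<in> bounded_faces L" for f
  proof -
    have "f \<inter> drawing L = {}"
      using that in_components_subset by (fastforce simp: bounded_faces_def faces_def)
    then show ?thesis using curve_half_in_path_image[of L] edge_subset_drawing[of _ L] by blast
  qed
  have seg: "path_image (straight_curve ?q m) \<subseteq> f \<union> ?q ` m"
    and ncol: "\<not> collinear (?q ` boundary_edges L f)"
    if f: "f \<in> bounded_faces L" and m: "card m = 2" "m \<subseteq> boundary_edges L f" for f m
  proof -
    obtain a b c where abc: "a \<noteq> b" "b \<noteq> c" "a \<noteq> c" "{a, b} \<in> edges L" "{b, c} \<in> edges L"
      "{a, c} \<in> edges L" "f = inside (triangle L a b c)"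
      using faces[OF f] by blast
    have BE: "boundary_edges L f = {{a, b}, {b, c}, {a, c}}"
      unfolding abc(7) by (rule boundary_edges_inside_triangle[OF L abc(4-6,1-3)])
    let ?a = "point L a" and ?b = "point L b" and ?c = "point L c"
    have tri: "triangle L a b c = closed_segment ?a ?b \<union> closed_segment ?b ?c \<union> closed_segment ?a ?c"
      using abc(4-6) str by (simp add: triangle_def path_image_straight_curve)
    have "f \<noteq> {}" using f in_components_nonempty by (auto simp: bounded_faces_def faces_def)
    then have nc: "\<not> collinear {?a, ?b, ?c}"
      using inside_triangle_nonempty_not_collinear abc(7) tri by metis
    have q: "?q {a, b} = midpoint ?a ?b" "?q {b, c} = midpoint ?b ?c" "?q {a, c} = midpoint ?a ?c"
      using abc(4-6) str straight_curve_half[of "point L"] by auto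
    show "\<not> collinear (?q ` boundary_edges L f)"
      unfolding BE using collinear_midpoints[of ?a ?b ?c] nc q by auto
    have perm: "{?b, ?c, ?a} = {?a, ?b, ?c}" "{?b, ?a, ?c} = {?a, ?b, ?c}" by auto
    have tri': "closed_segment ?b ?c \<union> closed_segment ?c ?a \<union> closed_segment ?b ?a = triangle L a b c"
      "closed_segment ?b ?a \<union> closed_segment ?a ?c \<union> closed_segment ?b ?c = triangle L a b c"
      unfolding tri by (auto simp: closed_segment_commute)
    obtain x y where xy: "m = {x, y}" "x \<noteq> y" using m(1) by (auto simp: card_2_iff)
    then have "x = {a, b} \<or> x = {b, c} \<or> x = {a, c}" "y = {a, b} \<or> y = {b, c} \<or> y = {a, c}"
      using m(2) unfolding BE by auto
    then have "m = {{a, b}, {b, c}} \<or> m = {{b, c}, {a, c}} \<or> m = {{a, b}, {a, c}}"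
      using xy by (elim disjE) (simp_all add: insert_commute)
    then show "path_image (straight_curve ?q m) \<subseteq> f \<union> ?q ` m"
    proof (elim disjE)
      assume m: "m = {{a, b}, {b, c}}"
      show ?thesis unfolding m path_image_straight_curve q abc(7)
        using medial_segment_subset[OF nc] tri q by simp
    next
      assume m: "m = {{b, c}, {a, c}}"
      show ?thesis unfolding m path_image_straight_curve q abc(7)
        using medial_segment_subset[of ?b ?c ?a] nc perm tri' q by (simp add: midpoint_sym)
    next
      assume m: "m = {{a, b}, {a, c}}"
      show ?thesis unfolding m path_image_straight_curve q abc(7)
        using medial_segment_subset[of ?b ?a ?c] nc perm tri' q by (simp add: midpoint_sym)
    qed
  qed
  let ?M = "{m. card m = 2 \<and> (\<exists>f\<in>bounded_faces L. m \<subseteq> boundary_edges L f)}"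
  have M_L: "m \<subseteq> edges L" if "m \<in> ?M" for m using that BE_edges by blast
  have "plane_graph (straight_graph (edges L) ?M ?q)"
  proof (rule plane_graph_straight[OF _ inj])
    show "simple_graph (edges L) ?M"
      unfolding simple_graph_def using plane_graph_finite(2)[OF L] M_L by blast
    show "path_image (straight_curve ?q m) \<inter> ?q ` edges L \<subseteq> ?q ` m" if "m \<in> ?M" for m
      using that seg off by blast
    show "path_image (straight_curve ?q m) \<inter> path_image (straight_curve ?q m') \<subseteq> ?q ` (m \<inter> m')"
      if mm: "m \<in> ?M" "m' \<in> ?M" "m \<noteq> m'" for m m'
    proof -
      obtain f g where f: "f \<in> bounded_faces L" "m \<subseteq> boundary_edges L f" "card m = 2"
        and g: "g \<in> bounded_faces L" "m' \<subseteq> boundary_edges L g" "card m' = 2" using mm by blast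
      show ?thesis
      proof (cases "f = g")
        case False
        then have "f \<inter> g = {}"
          using f(1) g(1) components_nonoverlap by (auto simp: bounded_faces_def faces_def)
        moreover have "?q ` m \<inter> ?q ` m' = ?q ` (m \<inter> m')"
          using inj_on_image_Int[OF inj M_L[OF mm(1)] M_L[OF mm(2)]] by simp
        moreover have "f \<inter> ?q ` m' = {}" "g \<inter> ?q ` m = {}"
          using off[OF f(1)] off[OF g(1)] image_mono[OF M_L[OF mm(1)], of ?q]
            image_mono[OF M_L[OF mm(2)], of ?q] by (meson disjoint_iff subsetD)+
        moreover have "A \<inter> B \<subseteq> a \<inter> b"
          if "A \<subseteq> f \<union> a" "B \<subseteq> g \<union> b" "f \<inter> g = {}" "f \<inter> b = {}" "g \<inter> a = {}" for A B a b
          using that by blast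
        ultimately show ?thesis using seg[OF f(1,3,2)] seg[OF g(1,3,2)] by metis
      next
        case True
        obtain a b c where abc: "a \<noteq> b" "b \<noteq> c" "a \<noteq> c" "{a, b} \<in> edges L" "{b, c} \<in> edges L"
          "{a, c} \<in> edges L" "f = inside (triangle L a b c)"
          using faces[OF f(1)] by blast
        have BE: "boundary_edges L f = {{a, b}, {b, c}, {a, c}}"
          unfolding abc(7) by (rule boundary_edges_inside_triangle[OF L abc(4-6,1-3)])
        have "{a, b} \<noteq> {b, c}" "{b, c} \<noteq> {a, c}" "{a, b} \<noteq> {a, c}"
          using abc(1-3) by (auto simp: doubleton_eq_iff)
        from card_2_in_triple[OF f(3) f(2)[unfolded BE] this]
        obtain x y z where xyz: "m = {x, y}" "boundary_edges L f = {x, y, z}" "x \<noteq> y" "y \<noteq> z" "x \<noteq> z"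
          unfolding BE .
        have "m' = {x, z} \<or> m' = {y, z}"
        proof -
          obtain u v where uv: "m' = {u, v}" "u \<noteq> v" using g(3) by (auto simp: card_2_iff)
          have "u = x \<or> u = y \<or> u = z" "v = x \<or> v = y \<or> v = z"
            using g(2) True xyz(2) uv(1) by auto
          then show ?thesis using uv mm(3) xyz(1) by (metis insert_commute)
        qed
        moreover have nc: "\<not> collinear {?q x, ?q y, ?q z}"
          using ncol[OF f(1,3,2)] unfolding xyz(2) by simp
        \<comment> \<open>Two medians of one face share exactly one midpoint, and segments from a
          common end towards noncollinear points meet only there.\<close>
        have "closed_segment (?q y) (?q x) \<inter> closed_segment (?q x) (?q z) = {?q x}"
          by (rule Int_closed_segment) (use nc in \<open>simp add: insert_commute\<close>)
        moreover have "closed_segment (?q x) (?q y) \<inter> closed_segment (?q y) (?q z) = {?q y}"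
          by (rule Int_closed_segment) (use nc in simp)
        ultimately show ?thesis
          unfolding xyz(1) by (elim disjE) (auto simp: path_image_straight_curve closed_segment_commute)
      qed
    qed
  qed
  moreover have "triangular_face L f" if "f \<in> bounded_faces L" for f
    using faces[OF that] boundary_edges_inside_triangle(3)[OF L] by (metis insert_subset)
  ultimately show ?thesis
    unfolding conjugated_triangulation_def medial_graph_def using seg
    by (intro conjI ballI allI impI) simp_all
qed

section \<open>The triangular bipyramid\<close>

text \<open>\<open>K4_split\<close> is applied twice: \<open>d\<close> splits the outer triangle,
  and \<open>e\<close> splits the part \<open>?P\<close> of it. The three parts of \<open>?P\<close>
  and the two untouched ones are the five faces; the absent edge is \<open>{c, e}\<close>.\<close>

lemma bounded_faces_K5_minus_edge:
  assumes G: "plane_graph G" and dist: "distinct [a, b, c, d, e]" and V: "verts G = {a, b, c, d, e}"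
    and E: "edges G = {{a, b}, {b, c}, {a, c}, {a, d}, {b, d}, {c, d}, {a, e}, {b, e}, {d, e}}"
    and d: "point G d \<in> inside (triangle G a b c)" and e: "point G e \<in> inside (triangle G a b d)"
  shows "bounded_faces G = {inside (triangle G a b e), inside (triangle G b d e),
    inside (triangle G a d e), inside (triangle G b c d), inside (triangle G a c d)}"
    (is "_ = {?P1, ?P2, ?P3, ?Q, ?R}")
proof -
  let ?X = "inside (triangle G a b c)" and ?P = "inside (triangle G a b d)" and ?J = "triangle G a b c"
  let ?I = "edge_image G"
  have Es: "{a, b} \<in> edges G" "{b, c} \<in> edges G" "{a, c} \<in> edges G" "{a, d} \<in> edges G"
    "{b, d} \<in> edges G" "{c, d} \<in> edges G" "{a, e} \<in> edges G" "{b, e} \<in> edges G" "{d, e} \<in> edges G"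
    using E by blast+
  have ne: "a \<noteq> b" "a \<noteq> c" "a \<noteq> d" "a \<noteq> e" "b \<noteq> c" "b \<noteq> d" "b \<noteq> e" "c \<noteq> d" "c \<noteq> e" "d \<noteq> e"
    using dist by auto
  have d4: "distinct [a, b, c, d]" "distinct [a, b, d, e]" using ne by auto
  note s1 = K4_split[OF G d4(1) Es(1-6) d]
  note s2 = K4_split[OF G d4(2) Es(1,5,4,7,8,9) e]
  note ends = arc_between_ends(1,2)[OF plane_graph_arc[OF G Es(1)]]
    arc_between_ends(1,2)[OF plane_graph_arc[OF G Es(6)]]
    arc_between_ends(1,2)[OF plane_graph_arc[OF G Es(9)]]
  let ?D = "?J \<union> ?I a d \<union> ?I b d \<union> ?I c d \<union> ?I a e \<union> ?I b e \<union> ?I d e"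
  \<comment> \<open>No vertex is isolated: these three edges already contain all five.\<close>
  have "point G ` verts G \<subseteq> ?I a b \<union> ?I c d \<union> ?I d e" unfolding V using ends by simp
  moreover have "(\<Union>k\<in>edges G. path_image (curve G k)) = ?D"
    unfolding E triangle_def by (simp add: Un_assoc)
  ultimately have D: "drawing G = ?D" unfolding drawing_def triangle_def by blast
  have XJ: "?X \<inter> ?J = {}" by simp
  have aJ: "point G a \<in> ?J" "point G b \<in> ?J" using ends by (auto simp: triangle_def)
  have P_sub: "?P \<subseteq> ?X" "?Q \<subseteq> ?X" "?R \<subseteq> ?X" unfolding s1(1) by blast+
  have P123: "?P1 \<subseteq> ?P" "?P2 \<subseteq> ?P" "?P3 \<subseteq> ?P" unfolding s2(1) by blast+
  have I_e: "?I a e \<subseteq> ?P \<union> {point G a}" "?I b e \<subseteq> ?P \<union> {point G b}" "?I d e \<subseteq> ?P \<union> {point G d}"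
    unfolding s2(1) by blast+
  have I_d: "?I a d \<subseteq> ?X \<union> {point G a}" "?I b d \<subseteq> ?X \<union> {point G b}" "?I c d \<subseteq> ?X \<union> {point G c}"
    unfolding s1(1) by blast+
  have cJ: "point G c \<in> ?J"
    using arc_between_ends(2)[OF plane_graph_arc[OF G Es(3)]] by (auto simp: triangle_def)
  have DX: "?D \<subseteq> ?X \<union> ?J"
  proof -
    have "?I a e \<subseteq> ?X \<union> ?J" "?I b e \<subseteq> ?X \<union> ?J" "?I d e \<subseteq> ?X \<union> ?J"
      using I_e P_sub(1) aJ d by blast+
    moreover have "?I a d \<subseteq> ?X \<union> ?J" "?I b d \<subseteq> ?X \<union> ?J" "?I c d \<subseteq> ?X \<union> ?J"
      using I_d aJ cJ by blast+
    ultimately show ?thesis by simp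
  qed
  \<comment> \<open>The edges at \<open>e\<close> lie in \<open>?P\<close> except for their ends, so
    a region off \<open>?P\<close> has to avoid only the outer triangle and the edges at
    \<open>d\<close>.\<close>
  have QD: "T \<inter> ?D = {}" if "T \<subseteq> ?X" "T \<inter> ?P = {}" "T \<inter> (?I a d \<union> ?I b d \<union> ?I c d) = {}" for T
  proof -
    have T: "T \<inter> ?J = {}" using that(1) XJ by blast
    have "point G a \<notin> T" "point G b \<notin> T" "point G d \<notin> T" using T aJ that(3) ends(4) by blast+
    then have "T \<inter> ?I a e = {}" "T \<inter> ?I b e = {}" "T \<inter> ?I d e = {}"
      using that(2) I_e(1) I_e(2) I_e(3) by blast+
    then show ?thesis using T that(3) by (simp add: Int_Un_distrib)
  qed
  have PD: "T \<inter> ?D = {}" if "T \<subseteq> ?P" "T \<inter> (?I a e \<union> ?I b e \<union> ?I d e) = {}" for T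
  proof -
    have "T \<inter> ?J = {}" using that(1) P_sub(1) XJ by blast
    moreover have "T \<inter> (?I a d \<union> ?I b d \<union> ?I c d) = {}" using that(1) s1(5) by blast
    ultimately show ?thesis using that(2) by (simp add: Int_Un_distrib)
  qed
  have disj: "?P1 \<inter> ?D = {}" "?P2 \<inter> ?D = {}" "?P3 \<inter> ?D = {}"
    using PD P123 s2(5) by (simp_all add: Int_Un_distrib2)
  have disj': "?Q \<inter> ?D = {}" "?R \<inter> ?D = {}"
    using QD P_sub s1(2,3,5) by (simp_all add: Int_Un_distrib2 Int_commute)
  have tri: "jordan_curve (triangle G x y z) \<and> triangle G x y z \<subseteq> drawing G"
    if "{x, y} \<in> edges G" "{y, z} \<in> edges G" "{x, z} \<in> edges G" "x \<noteq> y" "y \<noteq> z" "x \<noteq> z" for x y z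
    using triangle_jordan[OF G that] edge_subset_drawing[OF that(1)] edge_subset_drawing[OF that(2)]
      edge_subset_drawing[OF that(3)] unfolding triangle_def by blast
  have face: "f = inside (triangle G x y z)"
    if f: "f \<in> faces G" "f \<inter> inside (triangle G x y z) \<noteq> {}"
      and "{x, y} \<in> edges G" "{y, z} \<in> edges G" "{x, z} \<in> edges G" "x \<noteq> y" "y \<noteq> z" "x \<noteq> z"
      and "inside (triangle G x y z) \<inter> ?D = {}" for f x y z
    by (rule component_eqI[of _ "drawing G"])
      (use that tri[of x y z] jordan_curve_props(5,7)[of "triangle G x y z"] D in \<open>simp_all add: faces_def\<close>)
  have face': "inside (triangle G x y z) \<in> bounded_faces G"
    if "{x, y} \<in> edges G" "{y, z} \<in> edges G" "{x, z} \<in> edges G" "x \<noteq> y" "y \<noteq> z" "x \<noteq> z"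
      and "inside (triangle G x y z) \<inter> ?D = {}" for x y z
  proof -
    have j: "jordan_curve (triangle G x y z)" using tri that by blast
    obtain t where t: "t \<in> inside (triangle G x y z)" using jordan_curve_props(3)[OF j] by blast
    let ?f = "connected_component_set (- drawing G) t"
    have "t \<in> - drawing G" using t that(7) D by blast
    then have f: "?f \<in> faces G" "t \<in> ?f" by (auto simp: faces_def intro: componentsI)
    have "?f = inside (triangle G x y z)"
      by (rule face[OF f(1) _ that]) (use f(2) t in blast)
    with f(1) show ?thesis using jordan_curve_props(6)[OF j] by (simp add: bounded_faces_def)
  qed
  have J: "jordan_curve ?J" using tri Es(1-3) ne by blast
  have "f \<in> {?P1, ?P2, ?P3, ?Q, ?R}" if f: "f \<in> bounded_faces G" for f
  proof -
    have comp: "f \<in> faces G" "f \<in> components (- drawing G)" "bounded f"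
      using f by (auto simp: bounded_faces_def faces_def)
    have fD: "f \<inter> ?D = {}" "f \<noteq> {}"
      using in_components_subset[OF comp(2)] in_components_nonempty[OF comp(2)] D by blast+
    \<comment> \<open>Everything is drawn in or on the outer triangle. A face that meets its outside
      contains it and is unbounded.\<close>
    have "f \<inter> outside ?J = {}"
    proof (rule ccontr)
      assume *: "f \<inter> outside ?J \<noteq> {}"
      have "outside ?J \<inter> ?X = {}" "outside ?J \<inter> ?J = {}"
        using inside_Int_outside[of ?J] outside_no_overlap[of ?J] by blast+
      then have "outside ?J \<subseteq> - drawing G" unfolding D using DX by blast
      then have "outside ?J \<subseteq> f"
        using components_maximal[OF comp(2) jordan_curve_props(9)[OF J] _ *] by blast
      then show False using bounded_subset[OF comp(3)] jordan_curve_props(10)[OF J] by blast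
    qed
    then obtain t where t: "t \<in> f" "t \<in> ?X" "t \<notin> ?D"
      using fD inside_Un_outside[of ?J] by blast
    then have "t \<in> ?P1 \<or> t \<in> ?P2 \<or> t \<in> ?P3 \<or> t \<in> ?Q \<or> t \<in> ?R"
      using t unfolding s1(1) s2(1) by blast
    then have "f \<inter> ?P1 \<noteq> {} \<or> f \<inter> ?P2 \<noteq> {} \<or> f \<inter> ?P3 \<noteq> {} \<or> f \<inter> ?Q \<noteq> {} \<or> f \<inter> ?R \<noteq> {}"
      using t(1) by blast
    moreover have "f = ?P1" if "f \<inter> ?P1 \<noteq> {}"
      using face[OF comp(1) that] Es ne disj by simp
    moreover have "f = ?P2" if "f \<inter> ?P2 \<noteq> {}"
      using face[OF comp(1) that] Es ne disj by simp
    moreover have "f = ?P3" if "f \<inter> ?P3 \<noteq> {}"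
      using face[OF comp(1) that] Es ne disj by simp
    moreover have "f = ?Q" if "f \<inter> ?Q \<noteq> {}"
      using face[OF comp(1) that] Es ne disj' by simp
    moreover have "f = ?R" if "f \<inter> ?R \<noteq> {}"
      using face[OF comp(1) that] Es ne disj' by simp
    ultimately show ?thesis unfolding insert_iff empty_iff by argo
  qed
  moreover have "{?P1, ?P2, ?P3, ?Q, ?R} \<subseteq> bounded_faces G"
    using face' Es ne disj disj' by simp
  ultimately show ?thesis by blast
qed

section \<open>Faces of \<open>H\<close> around vertices of \<open>L\<close>\<close>

lemma conjugated_drawing_Int:
  assumes LH: "conjugated_triangulation L H"
  shows "drawing H \<inter> drawing L \<subseteq> point H ` edges L"
proof -
  have "path_image (curve H m) \<inter> drawing L \<subseteq> point H ` edges L" if m: "m \<in> edges H" for m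
  proof -
    obtain f where f: "f \<in> bounded_faces L" "card m = 2" "m \<subseteq> boundary_edges L f"
      using LH m by (auto simp: conjugated_triangulation_def)
    have "path_image (curve H m) \<subseteq> f \<union> point H ` m"
      using LH f by (auto simp: conjugated_triangulation_def)
    moreover have "f \<inter> drawing L = {}"
      using f(1) in_components_subset by (fastforce simp: bounded_faces_def faces_def)
    moreover have "m \<subseteq> edges L" using f(3) by (auto simp: boundary_edges_def)
    ultimately show ?thesis by blast
  qed
  moreover have "drawing H = point H ` edges L \<union> (\<Union>m\<in>edges H. path_image (curve H m))"
    using LH by (simp add: drawing_def conjugated_triangulation_def)
  ultimately show ?thesis by blast
qed

text \<open>Half of an edge of \<open>L\<close> joins its end to its midpoint without meeting any median.\<close>
lemma vertex_component:
  assumes L: "plane_graph L" and LH: "conjugated_triangulation L H" and E: "{u, v} \<in> edges L"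
  defines "F \<equiv> connected_component_set (- drawing H) (point L u)"
  shows "F \<in> faces H" "point L u \<in> F" "{u, v} \<in> boundary_verts H F"
proof -
  let ?x = "curve L {u, v} (1/2)" and ?I = "edge_image L u v"
  have qH: "point H e = curve L e (1/2)" if "e \<in> edges L" for e
    using LH that by (simp add: conjugated_triangulation_def)
  have A: "arc_between ?I (point L u) (point L v)" by (rule plane_graph_arc[OF L E])
  have x: "?x \<in> ?I" by (rule curve_half_in_path_image)
  have "?x \<notin> point L ` {u, v}" by (rule curve_half_notin_ends[OF L E])
  then have "?x \<noteq> point L u" "?x \<noteq> point L v" by auto
  then obtain B C where B: "arc_between B (point L u) ?x" "B \<union> C = ?I"
    using arc_between_split[OF A x] by metis
  have "?I \<inter> drawing H \<subseteq> {?x}"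
  proof
    fix z assume z: "z \<in> ?I \<inter> drawing H"
    then obtain e where "e \<in> edges L" "z = curve L e (1/2)"
      using conjugated_drawing_Int[OF LH] edge_subset_drawing[OF E] qH by blast
    then show "z \<in> {?x}" using curve_half_in_edge[OF L _ E] z by blast
  qed
  then have BD: "B - {?x} \<subseteq> - drawing H" using B(2) by blast
  have u: "point L u \<in> B - {?x}" using arc_between_ends(1)[OF B(1)] \<open>?x \<noteq> point L u\<close> by simp
  then show F: "F \<in> faces H" "point L u \<in> F"
    using BD by (auto simp: F_def faces_def intro: componentsI)
  have BF: "B - {?x} \<subseteq> F"
    unfolding F_def by (rule connected_component_maximal[OF u arc_between_connected_diff[OF B(1)] BD])
  \<comment> \<open>The half edge without its end \<open>?x\<close> lies in \<open>F\<close>, so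
    \<open>?x\<close> is a limit of points of \<open>F\<close>; being drawn in \<open>H\<close>, it
    is not in \<open>F\<close> itself.\<close>
  have "B \<subseteq> closure (B - {point L u, ?x})" by (rule arc_between_subset_closure[OF B(1)])
  also have "\<dots> \<subseteq> closure F" by (rule closure_mono) (use BF in blast)
  finally have "?x \<in> closure F" using arc_between_ends(2)[OF B(1)] by blast
  moreover have "?x \<in> drawing H"
    using qH[OF E] E LH by (auto simp: drawing_def conjugated_triangulation_def)
  then have "?x \<notin> F" using F(1) in_components_subset by (fastforce simp: faces_def)
  ultimately have "?x \<in> frontier F" using interior_subset by (auto simp: frontier_def)
  then show "{u, v} \<in> boundary_verts H F"
    using qH[OF E] E LH by (simp add: boundary_verts_def conjugated_triangulation_def)
qed

lemma median_in_drawing: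
  assumes L: "plane_graph L" and "is_straight L"
    and E: "{a, b} \<in> edges L" "{b, c} \<in> edges L" "{a, c} \<in> edges L" "a \<noteq> b" "b \<noteq> c" "a \<noteq> c"
    and f: "inside (triangle L a b c) \<in> bounded_faces L"
  shows "closed_segment (midpoint (point L a) (point L b)) (midpoint (point L b) (point L c))
    \<subseteq> drawing (medial_graph L)"
proof -
  have "{a, b} \<noteq> {b, c}" using E by (auto simp: doubleton_eq_iff)
  then have "{{a, b}, {b, c}} \<in> edges (medial_graph L)"
    using f boundary_edges_inside_triangle(1)[OF L E] by (auto simp: medial_graph_def)
  from edge_subset_drawing[OF this] show ?thesis
    using assms(2) E(1,2)
    by (simp add: medial_graph_def path_image_straight_curve is_straight_def straight_curve_half)
qed

text \<open>0, 1, 2 form the outer triangle, with 3 and 4 below 2 on its axis. The heights 8, 4, 2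
  halve, so each new vertex is halfway up the previous isosceles triangle; all coordinates are even,
  so all midpoints have integer coordinates.\<close>

definition position :: "nat \<Rightarrow> complex" where
  "position n = (if n = 0 then Complex (-4) 0 else if n = 1 then Complex 4 0
    else if n = 2 then Complex 0 8 else if n = 3 then Complex 0 4 else Complex 0 2)"

text \<open>All pairs except \<open>{2, 4}\<close>: these two are the apexes over the triangle 0, 1,
  3.\<close>

definition bipyramid_edges :: "nat set set" where
  "bipyramid_edges = {{0, 1}, {1, 2}, {0, 2}, {0, 3}, {1, 3}, {2, 3}, {0, 4}, {1, 4}, {3, 4}}"

definition bipyramid :: "nat plane_graph" where
  "bipyramid = straight_graph {0, 1, 2, 3, 4} bipyramid_edges position"

lemma in_closed_segment_Complex:
  "z \<in> closed_segment (Complex a b) (Complex c d) \<longleftrightarrow>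
    (\<exists>u. 0 \<le> u \<and> u \<le> 1 \<and> Re z = (1 - u) * a + u * c \<and> Im z = (1 - u) * b + u * d)"
  by (auto simp: closed_segment_def complex_eq_iff)

lemma position_simps:
  "position 0 = Complex (-4) 0" "position 1 = Complex 4 0" "position (Suc 0) = Complex 4 0"
  "position 2 = Complex 0 8" "position 3 = Complex 0 4" "position 4 = Complex 0 2"
  by (simp_all add: position_def)

text \<open>Planarity becomes linear arithmetic on real and imaginary parts. The conditions are just
  sharp enough to tell the edges apart, so \<open>{0, 1}\<close> gives its whole line and
  \<open>{2, 3}\<close> gets no upper bound.\<close>

lemma in_bipyramid_edge:
  assumes "e \<in> bipyramid_edges" "z \<in> path_image (straight_curve position e)"
  shows "e = {0, 1} \<and> Im z = 0
    \<or> e = {1, 2} \<and> Im z = 8 - 2 * Re z \<and> 0 \<le> Re z \<and> Re z \<le> 4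
    \<or> e = {0, 2} \<and> Im z = 8 + 2 * Re z \<and> -4 \<le> Re z \<and> Re z \<le> 0
    \<or> e = {0, 3} \<and> Im z = 4 + Re z \<and> -4 \<le> Re z \<and> Re z \<le> 0
    \<or> e = {1, 3} \<and> Im z = 4 - Re z \<and> 0 \<le> Re z \<and> Re z \<le> 4
    \<or> e = {2, 3} \<and> Re z = 0 \<and> 4 \<le> Im z
    \<or> e = {0, 4} \<and> Im z = 2 + Re z / 2 \<and> -4 \<le> Re z \<and> Re z \<le> 0
    \<or> e = {1, 4} \<and> Im z = 2 - Re z / 2 \<and> 0 \<le> Re z \<and> Re z \<le> 4
    \<or> e = {3, 4} \<and> Re z = 0 \<and> 2 \<le> Im z \<and> Im z \<le> 4"
proof -
  have "z \<in> closed_segment (position 0) (position 1) \<Longrightarrow> Im z = 0"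
    "z \<in> closed_segment (position 1) (position 2) \<Longrightarrow> Im z = 8 - 2 * Re z \<and> 0 \<le> Re z \<and> Re z \<le> 4"
    "z \<in> closed_segment (position 0) (position 2) \<Longrightarrow> Im z = 8 + 2 * Re z \<and> -4 \<le> Re z \<and> Re z \<le> 0"
    "z \<in> closed_segment (position 0) (position 3) \<Longrightarrow> Im z = 4 + Re z \<and> -4 \<le> Re z \<and> Re z \<le> 0"
    "z \<in> closed_segment (position 1) (position 3) \<Longrightarrow> Im z = 4 - Re z \<and> 0 \<le> Re z \<and> Re z \<le> 4"
    "z \<in> closed_segment (position 2) (position 3) \<Longrightarrow> Re z = 0 \<and> 4 \<le> Im z"
    "z \<in> closed_segment (position 0) (position 4) \<Longrightarrow> Im z = 2 + Re z / 2 \<and> -4 \<le> Re z \<and> Re z \<le> 0"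
    "z \<in> closed_segment (position 1) (position 4) \<Longrightarrow> Im z = 2 - Re z / 2 \<and> 0 \<le> Re z \<and> Re z \<le> 4"
    "z \<in> closed_segment (position 3) (position 4) \<Longrightarrow> Re z = 0 \<and> 2 \<le> Im z \<and> Im z \<le> 4"
    by (auto simp: position_simps in_closed_segment_Complex algebra_simps)
  then show ?thesis
    using assms unfolding bipyramid_edges_def path_image_straight_curve[symmetric] insert_iff empty_iff
    by metis
qed

lemma bipyramid_straight: "is_straight bipyramid"
  by (simp add: is_straight_def bipyramid_def)

lemma eq_position_iff:
  "z = position 0 \<longleftrightarrow> Re z = -4 \<and> Im z = 0" "z = position 1 \<longleftrightarrow> Re z = 4 \<and> Im z = 0"
  "z = position (Suc 0) \<longleftrightarrow> Re z = 4 \<and> Im z = 0"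
  "z = position 2 \<longleftrightarrow> Re z = 0 \<and> Im z = 8" "z = position 3 \<longleftrightarrow> Re z = 0 \<and> Im z = 4"
  "z = position 4 \<longleftrightarrow> Re z = 0 \<and> Im z = 2"
  by (simp_all add: position_simps complex_eq_iff)

lemma bipyramid_plane: "plane_graph bipyramid"
  unfolding bipyramid_def
proof (rule plane_graph_straight)
  let ?p = "\<lambda>e. path_image (straight_curve position e)"
  show "simple_graph {0, 1, 2, 3, 4} bipyramid_edges"
    by (auto simp: simple_graph_def bipyramid_edges_def)
  show "inj_on position {0, 1, 2, 3, 4}" by (auto simp: inj_on_def position_def)
  show "?p e \<inter> position ` {0, 1, 2, 3, 4} \<subseteq> position ` e" if e: "e \<in> bipyramid_edges" for e
  proof
    fix z assume "z \<in> ?p e \<inter> position ` {0, 1, 2, 3, 4}"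
    then obtain v where v: "v = 0 \<or> v = 1 \<or> v = 2 \<or> v = 3 \<or> v = 4" "z = position v" "z \<in> ?p e"
      by auto
    have "v \<in> e" using v(1) in_bipyramid_edge[OF e v(3)] unfolding v(2)
      by (elim disjE conjE; simp add: position_simps)
    then show "z \<in> position ` e" using v(2) by blast
  qed
  show "?p e \<inter> ?p e' \<subseteq> position ` (e \<inter> e')"
    if e: "e \<in> bipyramid_edges" "e' \<in> bipyramid_edges" "e \<noteq> e'" for e e'
  proof
    fix z assume z: "z \<in> ?p e \<inter> ?p e'"
    have z: "z \<in> ?p e" "z \<in> ?p e'" using z by auto
    show "z \<in> position ` (e \<inter> e')"
      using e(3) in_bipyramid_edge[OF e(1) z(1)] in_bipyramid_edge[OF e(2) z(2)]
      by (elim disjE conjE; simp add: eq_position_iff; linarith?)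
  qed
qed

lemma pair_in_bipyramid_edges:
  fixes x y :: nat
  assumes "x \<in> {0, 1, 2, 3, 4}" "y \<in> {0, 1, 2, 3, 4}" "x \<noteq> y"
  shows "{x, y} \<in> bipyramid_edges \<union> {{2, 4}}"
proof -
  have "x = 0 \<or> x = 1 \<or> x = 2 \<or> x = 3 \<or> x = 4" "y = 0 \<or> y = 1 \<or> y = 2 \<or> y = 3 \<or> y = 4"
    using assms(1,2) by auto
  then show ?thesis
    using assms(3) by (elim disjE; simp add: bipyramid_edges_def doubleton_eq_iff)
qed

text \<open>The only pair left to add is \<open>{2, 4}\<close>, which completes
  \<open>K\<^sub>5\<close>. The drawing \<open>G\<close> of the larger graph is arbitrary and
  unrelated to \<open>position\<close>.\<close>

lemma bipyramid_maximal_planar: "maximal_planar (verts bipyramid) (edges bipyramid)"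
  unfolding maximal_planar_def
proof (intro conjI allI impI notI)
  show "simple_graph (verts bipyramid) (edges bipyramid)"
    using bipyramid_plane by (simp add: plane_graph_def)
  show "planar (verts bipyramid) (edges bipyramid)"
    using bipyramid_plane by (auto simp: planar_def)
  fix E' assume E': "simple_graph (verts bipyramid) E' \<and> edges bipyramid \<subset> E'"
    and "planar (verts bipyramid) E'"
  then obtain G where G: "plane_graph G" "verts G = {0, 1, 2, 3, 4}" "edges G = E'"
    by (auto simp: planar_def bipyramid_def)
  obtain k where k: "k \<in> E'" "k \<notin> bipyramid_edges" using E' by (auto simp: bipyramid_def)
  then have "card k = 2" "k \<subseteq> {0, 1, 2, 3, 4}"
    using E' by (auto simp: simple_graph_def bipyramid_def)
  then obtain x y where xy: "k = {x, y}" "x \<noteq> y" "x \<in> {0, 1, 2, 3, 4}" "y \<in> {0, 1, 2, 3, 4}"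
    by (auto simp: card_2_iff)
  have "k = {2, 4}" using pair_in_bipyramid_edges[OF xy(3,4,2)] k(2) xy(1) by blast
  then have E5: "bipyramid_edges \<union> {{2, 4}} \<subseteq> E'" using k(1) E' by (auto simp: bipyramid_def)
  show False
  proof (rule K5_not_plane[OF G(1), of 0 1 2 3 4])
    show "{x, y} \<in> edges G" if "x \<in> {0, 1, 2, 3, 4}" "y \<in> {0, 1, 2, 3, 4}" "x \<noteq> y" for x y
      using pair_in_bipyramid_edges[OF that] E5 G(3) by blast
  qed (use G(2) in auto)
qed

lemma not_collinear_Complex:
  assumes "a \<noteq> b" "c \<noteq> 0" shows "\<not> collinear {Complex a 0, Complex b 0, Complex d c}"
proof
  assume "collinear {Complex a 0, Complex b 0, Complex d c}"
  then obtain u where u: "\<forall>x\<in>{Complex a 0, Complex b 0, Complex d c}.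
      \<forall>y\<in>{Complex a 0, Complex b 0, Complex d c}. \<exists>t. x - y = t *\<^sub>R u"
    unfolding collinear_def by blast
  obtain s where "Complex a 0 - Complex b 0 = s *\<^sub>R u" using u by blast
  then have "a - b = s * Re u" "0 = s * Im u" by (auto simp: complex_eq_iff)
  then have "Im u = 0" using assms(1) by auto
  obtain t where "Complex d c - Complex b 0 = t *\<^sub>R u" using u by blast
  then have "c = t * Im u" by (auto simp: complex_eq_iff)
  then show False using \<open>Im u = 0\<close> assms(2) by simp
qed

lemma bipyramid_triangle:
  assumes "{{a, b}, {b, c}, {a, c}} \<subseteq> bipyramid_edges"
  shows "inside (triangle bipyramid a b c) = interior (convex hull {position a, position b, position c})"
  using inside_of_triangle[of "position a" "position b" "position c"]
  by (simp add: triangle_def bipyramid_def path_image_straight_curve closed_segment_commute)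

text \<open>The barycentric weights are one quarter at both ends of the base and one half at the
  apex. The cases \<open>t = 4\<close> and \<open>t = 2\<close> place the vertices 3 and 4.\<close>

lemma in_interior_isosceles:
  assumes "t \<noteq> 0"
  shows "Complex 0 t \<in> interior (convex hull {Complex (-4) 0, Complex 4 0, Complex 0 (2 * t)})"
proof -
  have nc: "\<not> collinear {Complex (-4) 0, Complex 4 0, Complex 0 (2 * t)}"
    by (rule not_collinear_Complex) (use assms in auto)
  show ?thesis
    unfolding interior_convex_hull_3_minimal[OF nc DIM_complex]
    by (intro CollectI exI[of _ "1/4"] exI[of _ "1/2"] conjI) (simp_all add: complex_eq_iff)
qed

lemma bipyramid_interior:
  "point bipyramid 3 \<in> inside (triangle bipyramid 0 1 2)"
  "point bipyramid 4 \<in> inside (triangle bipyramid 0 1 3)"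
proof -
  have e: "{{0, 1}, {1, 2}, {0, 2}} \<subseteq> bipyramid_edges" "{{0, 1}, {1, 3}, {0, 3}} \<subseteq> bipyramid_edges"
    by (auto simp: bipyramid_edges_def)
  show "point bipyramid 3 \<in> inside (triangle bipyramid 0 1 2)"
    unfolding bipyramid_triangle[OF e(1)] using in_interior_isosceles[of 4]
    by (simp add: bipyramid_def position_simps)
  show "point bipyramid 4 \<in> inside (triangle bipyramid 0 1 3)"
    unfolding bipyramid_triangle[OF e(2)] using in_interior_isosceles[of 2]
    by (simp add: bipyramid_def position_simps)
qed

lemma bipyramid_bounded_faces:
  "bounded_faces bipyramid = {inside (triangle bipyramid 0 1 4), inside (triangle bipyramid 1 3 4),
    inside (triangle bipyramid 0 3 4), inside (triangle bipyramid 1 2 3), inside (triangle bipyramid 0 2 3)}"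
  by (rule bounded_faces_K5_minus_edge[OF bipyramid_plane _ _ _ bipyramid_interior])
    (auto simp: bipyramid_def bipyramid_edges_def)

lemma bipyramid_conjugated: "conjugated_triangulation bipyramid (medial_graph bipyramid)"
proof (rule conjugated_medial_graph[OF bipyramid_plane bipyramid_straight])
  have E: "edges bipyramid = bipyramid_edges" by (simp add: bipyramid_def)
  have X: "\<exists>a b c. a \<noteq> b \<and> b \<noteq> c \<and> a \<noteq> c \<and>
      {{a, b}, {b, c}, {a, c}} \<subseteq> edges bipyramid \<and> inside (triangle bipyramid x y z) = inside (triangle bipyramid a b c)"
    if "x \<noteq> y" "y \<noteq> z" "x \<noteq> z" "{{x, y}, {y, z}, {x, z}} \<subseteq> edges bipyramid" for x y z
    using that by blast
  show "\<exists>a b c. a \<noteq> b \<and> b \<noteq> c \<and> a \<noteq> c \<and>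
      {{a, b}, {b, c}, {a, c}} \<subseteq> edges bipyramid \<and> f = inside (triangle bipyramid a b c)"
    if f: "f \<in> bounded_faces bipyramid" for f
    using f unfolding bipyramid_bounded_faces insert_iff empty_iff
    by (elim disjE FalseE; simp only:; intro X) (simp_all add: E bipyramid_edges_def)
qed

text \<open>The first four medians surround vertex 3, which has degree four; the last three surround
  vertex 4, which has degree three.\<close>

lemma bipyramid_medians:
  defines "D \<equiv> drawing (medial_graph bipyramid)"
  shows "closed_segment (Complex 2 2) (Complex 0 3) \<subseteq> D"
    "closed_segment (Complex (-2) 2) (Complex 0 3) \<subseteq> D"
    "closed_segment (Complex 2 2) (Complex 0 6) \<subseteq> D"
    "closed_segment (Complex (-2) 2) (Complex 0 6) \<subseteq> D"
    "closed_segment (Complex (-2) 1) (Complex 2 1) \<subseteq> D"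
    "closed_segment (Complex 2 1) (Complex 0 3) \<subseteq> D"
    "closed_segment (Complex (-2) 1) (Complex 0 3) \<subseteq> D"
proof -
  have med: "closed_segment u v \<subseteq> D"
    if "inside (triangle bipyramid a b c) \<in> bounded_faces bipyramid" "a \<noteq> b" "b \<noteq> c" "a \<noteq> c"
      "{a, b} \<in> bipyramid_edges" "{b, c} \<in> bipyramid_edges" "{a, c} \<in> bipyramid_edges"
      "midpoint (position a) (position b) = u" "midpoint (position b) (position c) = v" for a b c u v
    using median_in_drawing[OF bipyramid_plane bipyramid_straight, of a b c] that
    unfolding D_def by (simp add: bipyramid_def)
  \<comment> \<open>A median goes around the vertex named in the middle, so the faces are renamed to
    have 3 or 4 there.\<close>
  note perm = triangle_perm[of bipyramid]
  have f: "inside (triangle bipyramid 1 3 4) \<in> bounded_faces bipyramid"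
    "inside (triangle bipyramid 0 3 4) \<in> bounded_faces bipyramid"
    "inside (triangle bipyramid 1 3 2) \<in> bounded_faces bipyramid"
    "inside (triangle bipyramid 0 3 2) \<in> bounded_faces bipyramid"
    "inside (triangle bipyramid 0 4 1) \<in> bounded_faces bipyramid"
    "inside (triangle bipyramid 1 4 3) \<in> bounded_faces bipyramid"
    "inside (triangle bipyramid 0 4 3) \<in> bounded_faces bipyramid"
    unfolding bipyramid_bounded_faces
    using perm(2)[of 1 2 3] perm(2)[of 0 2 3] perm(2)[of 0 1 4] perm(2)[of 1 3 4] perm(2)[of 0 3 4]
    by auto
  show "closed_segment (Complex 2 2) (Complex 0 3) \<subseteq> D"
    by (rule med[OF f(1)]) (auto simp: bipyramid_edges_def position_simps midpoint_def complex_eq_iff)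
  show "closed_segment (Complex (-2) 2) (Complex 0 3) \<subseteq> D"
    by (rule med[OF f(2)]) (auto simp: bipyramid_edges_def position_simps midpoint_def complex_eq_iff)
  show "closed_segment (Complex 2 2) (Complex 0 6) \<subseteq> D"
    by (rule med[OF f(3)]) (auto simp: bipyramid_edges_def position_simps midpoint_def complex_eq_iff)
  show "closed_segment (Complex (-2) 2) (Complex 0 6) \<subseteq> D"
    by (rule med[OF f(4)]) (auto simp: bipyramid_edges_def position_simps midpoint_def complex_eq_iff)
  show "closed_segment (Complex (-2) 1) (Complex 2 1) \<subseteq> D"
    by (rule med[OF f(5)]) (auto simp: bipyramid_edges_def position_simps midpoint_def complex_eq_iff)
  show "closed_segment (Complex 2 1) (Complex 0 3) \<subseteq> D"
    by (rule med[OF f(6)]) (auto simp: bipyramid_edges_def position_simps midpoint_def complex_eq_iff)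
  show "closed_segment (Complex (-2) 1) (Complex 0 3) \<subseteq> D"
    by (rule med[OF f(7)]) (auto simp: bipyramid_edges_def position_simps midpoint_def complex_eq_iff)
qed

text \<open>The medians around the vertices 3 and 4 bound these two regions.\<close>
definition region3 :: "complex set" where
  "region3 = {z. 3 - \<bar>Re z\<bar> / 2 < Im z \<and> Im z < 6 - 2 * \<bar>Re z\<bar>}"

definition region4 :: "complex set" where
  "region4 = {z. 1 < Im z \<and> Im z < 3 - \<bar>Re z\<bar>}"

lemma bounded_regions: "bounded region3" "bounded region4"
proof -
  have "norm z \<le> 10" if "z \<in> region3 \<or> z \<in> region4" for z
  proof -
    have "\<bar>Re z\<bar> \<le> 2 \<and> \<bar>Im z\<bar> \<le> 6"
      using that unfolding region3_def region4_def mem_Collect_eq by linarith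
    then show ?thesis using cmod_le[of z] by linarith
  qed
  then show "bounded region3" "bounded region4" by (auto intro: boundedI)
qed

text \<open>The strict inequalities define an open set and the weak ones a closed set, so a frontier
  point satisfies the weak ones and violates a strict one.\<close>

lemma frontier_strict_between:
  fixes f g h :: "complex \<Rightarrow> real"
  assumes [continuous_intros]: "continuous_on UNIV f" "continuous_on UNIV g" "continuous_on UNIV h"
  shows "frontier {z. f z < g z \<and> g z < h z} \<subseteq> {z. f z \<le> g z \<and> g z \<le> h z \<and> (g z = f z \<or> g z = h z)}"
proof -
  have "open {z. f z < g z \<and> g z < h z}"
    by (intro open_Collect_conj open_Collect_less continuous_intros)
  moreover have "closed {z. f z \<le> g z \<and> g z \<le> h z}"
    by (intro closed_Collect_conj closed_Collect_le continuous_intros)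
  then have "closure {z. f z < g z \<and> g z < h z} \<subseteq> {z. f z \<le> g z \<and> g z \<le> h z}"
    by (intro closure_minimal) auto
  ultimately show ?thesis by (auto simp: frontier_def interior_open)
qed

lemma frontier_regions:
  "frontier region3 \<subseteq> drawing (medial_graph bipyramid)"
  "frontier region4 \<subseteq> drawing (medial_graph bipyramid)"
proof -
  \<comment> \<open>\<open>t\<close> is the weight of the end off the axis. These segments run from
    real part 2 or -2 to 0, so \<open>t\<close> is half the absolute value of the real part.\<close>
  have seg: "z \<in> drawing (medial_graph bipyramid)"
    if "closed_segment (Complex a b) (Complex 0 d) \<subseteq> drawing (medial_graph bipyramid)"
      "0 \<le> 1 - t" "0 \<le> t" "Re z = t * a" "Im z = t * b + (1 - t) * d" for z a b d t
    using that by (auto simp: subset_iff in_closed_segment_Complex intro!: exI[of _ "1 - t"])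
  show "frontier region3 \<subseteq> drawing (medial_graph bipyramid)"
  proof
    fix z assume "z \<in> frontier region3"
    moreover have "frontier region3 \<subseteq> {z. 3 - \<bar>Re z\<bar> / 2 \<le> Im z \<and> Im z \<le> 6 - 2 * \<bar>Re z\<bar> \<and>
        (Im z = 3 - \<bar>Re z\<bar> / 2 \<or> Im z = 6 - 2 * \<bar>Re z\<bar>)}"
      unfolding region3_def by (rule frontier_strict_between) (auto intro!: continuous_intros)
    ultimately have z: "3 - \<bar>Re z\<bar> / 2 \<le> Im z" "Im z \<le> 6 - 2 * \<bar>Re z\<bar>"
      "Im z = 3 - \<bar>Re z\<bar> / 2 \<or> Im z = 6 - 2 * \<bar>Re z\<bar>"
      by blast+
    consider "0 \<le> Re z" "Im z = 3 - Re z / 2" | "Re z \<le> 0" "Im z = 3 + Re z / 2"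
      | "0 \<le> Re z" "Im z = 6 - 2 * Re z" | "Re z \<le> 0" "Im z = 6 + 2 * Re z"
      using z(3) by linarith
    then show "z \<in> drawing (medial_graph bipyramid)"
    proof cases
      case 1
      then show ?thesis using z(1,2) by (intro seg[OF bipyramid_medians(1), of "Re z / 2"]) auto
    next
      case 2
      then show ?thesis using z(1,2) by (intro seg[OF bipyramid_medians(2), of "- Re z / 2"]) auto
    next
      case 3
      then show ?thesis using z(1,2) by (intro seg[OF bipyramid_medians(3), of "Re z / 2"]) auto
    next
      case 4
      then show ?thesis using z(1,2) by (intro seg[OF bipyramid_medians(4), of "- Re z / 2"]) auto
    qed
  qed
  show "frontier region4 \<subseteq> drawing (medial_graph bipyramid)"
  proof
    fix z assume "z \<in> frontier region4"
    moreover have "frontier region4 \<subseteq> {z. 1 \<le> Im z \<and> Im z \<le> 3 - \<bar>Re z\<bar> \<and>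
        (Im z = 1 \<or> Im z = 3 - \<bar>Re z\<bar>)}"
      unfolding region4_def by (rule frontier_strict_between) (auto intro!: continuous_intros)
    ultimately have z: "1 \<le> Im z" "Im z \<le> 3 - \<bar>Re z\<bar>" "Im z = 1 \<or> Im z = 3 - \<bar>Re z\<bar>"
      by blast+
    consider "Im z = 1" | "0 \<le> Re z" "Im z = 3 - Re z" | "Re z \<le> 0" "Im z = 3 + Re z"
      using z(3) by linarith
    then show "z \<in> drawing (medial_graph bipyramid)"
    proof cases
      case 1
      then have "z \<in> closed_segment (Complex (-2) 1) (Complex 2 1)"
        using z(1,2) unfolding in_closed_segment_Complex
        by (intro exI[of _ "(Re z + 2) / 4"]) (auto simp: field_simps)
      then show ?thesis using bipyramid_medians(5) by blast
    next
      case 2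
      then show ?thesis using z(1,2) by (intro seg[OF bipyramid_medians(6), of "Re z / 2"]) auto
    next
      case 3
      then show ?thesis using z(1,2) by (intro seg[OF bipyramid_medians(7), of "- Re z / 2"]) auto
    qed
  qed
qed

lemma second_class_faces_common_vertex:
  "\<exists>(L :: nat plane_graph) H F G.
      plane_triangulation L \<and> card (verts L) \<ge> 3 \<and> conjugated_triangulation L H \<and>
      F \<in> second_class_faces L H \<and> G \<in> second_class_faces L H \<and> F \<noteq> G \<and>
      boundary_verts H F \<inter> boundary_verts H G \<noteq> {}"
proof -
  let ?H = "medial_graph bipyramid"
  let ?F = "\<lambda>v. connected_component_set (- drawing ?H) (point bipyramid v)"
  have e: "{3, 4} \<in> edges bipyramid" "{4, 3} \<in> edges bipyramid"
    by (simp_all add: bipyramid_def bipyramid_edges_def insert_commute)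
  note c3 = vertex_component[OF bipyramid_plane bipyramid_conjugated e(1)]
  note c4 = vertex_component[OF bipyramid_plane bipyramid_conjugated e(2)]
  have p: "point bipyramid 3 \<in> region3" "point bipyramid 4 \<in> region4" "point bipyramid 4 \<notin> region3"
    by (simp_all add: bipyramid_def position_simps region3_def region4_def)
  have H: "plane_graph ?H" using bipyramid_conjugated by (simp add: conjugated_triangulation_def)
  \<comment> \<open>The two faces are not computed. Being trapped in the regions makes them bounded,
    and it makes them different because vertex 4 is not in \<open>region3\<close>.\<close>
  have sub: "?F 3 \<subseteq> region3" "?F 4 \<subseteq> region4"
    using frontier_subset_component[OF _ frontier_regions(1)] frontier_subset_component[OF _ frontier_regions(2)]
      c3(1,2) c4(1,2) p(1,2) unfolding faces_def by blast+
  have second: "?F v \<in> second_class_faces bipyramid ?H"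
    if "?F v \<in> faces ?H" "point bipyramid v \<in> ?F v" "bounded (?F v)" "v \<in> verts bipyramid" for v
  proof -
    have "open (?F v)"
      using that(1) open_components[OF open_Compl[OF closed_drawing[OF H]]] by (simp add: faces_def)
    then have "point bipyramid v \<in> interior (?F v)" using that(2) by (metis interior_open)
    then show ?thesis
      unfolding second_class_faces_def bounded_faces_def mem_Collect_eq using that by blast
  qed
  have "bounded (?F 3)" "bounded (?F 4)" using sub bounded_regions bounded_subset by blast+
  moreover have "3 \<in> verts bipyramid" "4 \<in> verts bipyramid" by (simp_all add: bipyramid_def)
  ultimately have "?F 3 \<in> second_class_faces bipyramid ?H" "?F 4 \<in> second_class_faces bipyramid ?H"
    using second c3(1,2) c4(1,2) by blast+
  moreover have "?F 3 \<noteq> ?F 4" using sub(1) p(3) c4(2) by blast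
  moreover have "boundary_verts ?H (?F 3) \<inter> boundary_verts ?H (?F 4) \<noteq> {}"
    using c3(3) c4(3) by (auto simp: insert_commute)
  moreover have "plane_triangulation bipyramid"
    using bipyramid_plane bipyramid_maximal_planar by (simp add: plane_triangulation_def)
  moreover have "card (verts bipyramid) \<ge> 3" by (simp add: bipyramid_def)
  ultimately show ?thesis using bipyramid_conjugated by blast
qed

text \<open>The example is given over \<open>nat\<close> because the type \<open>'a\<close> may have
  fewer than five elements; the second part holds over every type.\<close>

theorem theorem10:
  "(\<exists>(L :: nat plane_graph) H F G.
      plane_triangulation L \<and> card (verts L) \<ge> 3 \<and> conjugated_triangulation L H \<and>
      F \<in> second_class_faces L H \<and> G \<in> second_class_faces L H \<and> F \<noteq> G \<and>
      boundary_verts H F \<inter> boundary_verts H G \<noteq> {}) \<and>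
   (\<forall>(L :: 'a plane_graph) H F G.
      plane_triangulation L \<and> card (verts L) \<ge> 3 \<and> conjugated_triangulation L H \<and>
      F \<in> second_class_faces L H \<and> G \<in> second_class_faces L H \<and> F \<noteq> G \<longrightarrow>
      boundary_edges H F \<inter> boundary_edges H G = {})"
proof (intro conjI allI impI, goal_cases)
  case 1
  show ?case by (rule second_class_faces_common_vertex)
next
  case (2 L H F G)
  then have "plane_graph L" by (simp add: plane_triangulation_def)
  then show ?case using second_class_faces_common_edge_eq 2 by blast
qed

end
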